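(* Let $K$ be a field, $S=K[x_1,\ldots,x_n]$, and let $d$ be a positive integer. Let $I\supsetneq J$ be squarefree monomial ideals of $S$, where either $J=0$ or $J$ is generated by squarefree monomials of degrees $\geq d+1$. Suppose that $I$ is minimally generated by squarefree monomials $f_1,\ldots,f_k$ of degree $d$ and a set $H$ of squarefree monomials of degrees $\geq d+1$. Assume that $\operatorname{sdepth}_S I/J=d+1$, and that one of the following holds: (1) $k=1$; (2) $1<k\leq 3$ and $H=\emptyset$. Then $\operatorname{depth}_S I/J\leq d+1$.
   Context: Stanley depth: for squarefree monomial ideals $I\supsetneq J$ of $S=K[x_1,\ldots,x_n]$, a monomial $u\in I\setminus J$ and a set $Z\subset\{x_1,\ldots,x_n\}$ with $(J:u)\cap K[Z]=0$, let $uK[Z]$ be the $K$-subspace of $I/J$ generated by (the classes of) the elements $uf$, $f\in K[Z]$. A Stanley decomposition $\mathcal D$ of $I/J$ is a presentation of $I/J$ as a finite direct sum of $K$-vector spaces $I/J=\bigoplus_{i=1}^m u_iK[Z_i]$ of this kind; $\operatorname{sdepth}(\mathcal D)=\min_i|Z_i|$, and $\operatorname{sdepth}_S I/J$ is the maximum of $\operatorname{sdepth}(\mathcal D)$ over all Stanley decompositions $\mathcal D$ of $I/J$. $\operatorname{depth}_S$ denotes the usual depth of a finitely generated graded $S$-module with respect to $(x_1,\ldots,x_n)$. *)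

theory Defs
  imports Main "HOL-Library.Poly_Mapping" "HOL-Library.Extended_Nat"
begin

text \<open>
  The polynomial ring \<open>S = K[x_1, \<dots>, x_n]\<close> is the ring of finitely supported functions from exponent
  vectors to the field \<open>'k\<close>; the variables are indexed by the finite type \<open>'n\<close>, so \<open>n = CARD('n)\<close>.
\<close>

type_synonym 'n expo = "'n \<Rightarrow>\<^sub>0 nat"
type_synonym ('n, 'k) mpoly = "'n expo \<Rightarrow>\<^sub>0 'k"

definition monom :: "'n expo \<Rightarrow> ('n, 'k::field) mpoly" where
  "monom t = Poly_Mapping.single t 1"

definition var :: "'n \<Rightarrow> ('n, 'k::field) mpoly" where
  "var i = monom (Poly_Mapping.single i 1)"

definition deg :: "'n::finite expo \<Rightarrow> nat" where
  "deg t = (\<Sum>i\<in>UNIV. Poly_Mapping.lookup t i)"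

definition sqfree :: "'n expo \<Rightarrow> bool" where
  "sqfree t \<longleftrightarrow> (\<forall>i. Poly_Mapping.lookup t i \<le> 1)"

text \<open>Ideals are the submodules of the ring as a module over itself; \<open>ideal.span G\<close> is \<open>(G)\<close>.\<close>

global_interpretation ideal: module "(*) :: 'a::comm_ring_1 \<Rightarrow> 'a \<Rightarrow> 'a"
  by standard (simp_all add: algebra_simps)

definition sqfree_monomial_ideal :: "('n, 'k::field) mpoly set \<Rightarrow> bool" where
  "sqfree_monomial_ideal I \<longleftrightarrow> (\<exists>G. (\<forall>t\<in>G. sqfree t) \<and> I = ideal.span (monom ` G))"

definition minimally_generated_by :: "'a::comm_ring_1 set \<Rightarrow> 'a set \<Rightarrow> bool" where
  "minimally_generated_by I G \<longleftrightarrow> I = ideal.span G \<and> (\<forall>G'. G' \<subset> G \<longrightarrow> ideal.span G' \<noteq> I)"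

definition colon :: "'a::comm_ring_1 set \<Rightarrow> 'a \<Rightarrow> 'a set" where
  "colon J u = {f. f * u \<in> J}"


subsection \<open>Stanley depth\<close>

text \<open>The subalgebra \<open>K[Z]\<close> of \<open>S\<close>.\<close>

definition poly_in :: "'n set \<Rightarrow> ('n, 'k::field) mpoly set" where
  "poly_in Z = {f. \<forall>t\<in>Poly_Mapping.keys f. Poly_Mapping.keys t \<subseteq> Z}"

text \<open>Representatives in \<open>S\<close> of the elements of the subspace \<open>u K[Z]\<close> of \<open>I/J\<close>.\<close>

definition stanley_space :: "'n expo \<Rightarrow> 'n set \<Rightarrow> ('n, 'k::field) mpoly set" where
  "stanley_space u Z = (\<lambda>f. monom u * f) ` poly_in Z"

text \<open>
  For subspaces \<open>J \<subseteq> V\<close> and \<open>U 0, \<dots>, U (m - 1) \<subseteq> V\<close>: the space \<open>V/J\<close> is the internal direct sum of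
  the images of the \<open>U i\<close>, written out on representatives.
\<close>

definition direct_sum_mod :: "'a::ab_group_add set \<Rightarrow> 'a set \<Rightarrow> nat \<Rightarrow> (nat \<Rightarrow> 'a set) \<Rightarrow> bool" where
  "direct_sum_mod V J m U \<longleftrightarrow>
     (\<forall>f\<in>V. \<exists>g. (\<forall>i<m. g i \<in> U i) \<and> f - (\<Sum>i<m. g i) \<in> J) \<and>
     (\<forall>g. (\<forall>i<m. g i \<in> U i) \<and> (\<Sum>i<m. g i) \<in> J \<longrightarrow> (\<forall>i<m. g i \<in> J))"

definition stanley_decomposition ::
    "('n, 'k::field) mpoly set \<Rightarrow> ('n, 'k) mpoly set \<Rightarrow> ('n expo \<times> 'n set) list \<Rightarrow> bool" where
  "stanley_decomposition I J D \<longleftrightarrow>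
     (\<forall>(u, Z)\<in>set D. monom u \<in> I - J \<and> colon J (monom u) \<inter> poly_in Z = {0}) \<and>
     direct_sum_mod I J (length D) (\<lambda>i. stanley_space (fst (D ! i)) (snd (D ! i)))"

definition sdepth_decomp :: "('n expo \<times> 'n set) list \<Rightarrow> nat" where
  "sdepth_decomp D = Min ((\<lambda>(u, Z). card Z) ` set D)"

text \<open>
  For \<open>J \<subset> I\<close> every decomposition is nonempty and \<open>sdepth_decomp D \<le> CARD('n)\<close>, so the
  maximum is over a finite set.
\<close>

definition sdepth :: "('n::finite, 'k::field) mpoly set \<Rightarrow> ('n, 'k) mpoly set \<Rightarrow> nat" where
  "sdepth I J = Max {sdepth_decomp D | D. stanley_decomposition I J D}"


subsection \<open>Depth\<close>

text \<open>
  For \<open>M = I/J\<close>, the preimage in \<open>I\<close> of the submodule \<open>(A) M\<close>, i.e. \<open>(A) I + J\<close>;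
  hence \<open>M / (A) M\<close> is \<open>I\<close> modulo this ideal.
\<close>

definition mult_preimage :: "'a::comm_ring_1 set \<Rightarrow> 'a set \<Rightarrow> 'a set \<Rightarrow> 'a set" where
  "mult_preimage I J A = ideal.span ({a * f | a f. a \<in> A \<and> f \<in> I} \<union> J)"

text \<open>
  \<open>gs\<close> is an \<open>I/J\<close>-regular sequence: each \<open>gs ! i\<close> is a nonzerodivisor on
  \<open>M / (gs ! 0, \<dots>, gs ! (i - 1)) M\<close>, and \<open>M \<noteq> (gs) M\<close>.
\<close>

definition regular_sequence :: "'a::comm_ring_1 set \<Rightarrow> 'a set \<Rightarrow> 'a list \<Rightarrow> bool" where
  "regular_sequence I J gs \<longleftrightarrow>
     (\<forall>i<length gs. \<forall>f\<in>I. gs ! i * f \<in> mult_preimage I J (set (take i gs)) \<longrightarrow>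
        f \<in> mult_preimage I J (set (take i gs))) \<and>
     mult_preimage I J (set gs) \<noteq> I"

text \<open>
  The supremum is taken in \<open>enat\<close>, so no boundedness of the lengths is presupposed.
\<close>

definition depth :: "('n, 'k::field) mpoly set \<Rightarrow> ('n, 'k) mpoly set \<Rightarrow> enat" where
  "depth I J = Sup {enat (length gs) | gs.
     set gs \<subseteq> ideal.span (range var) \<and> regular_sequence I J gs}"

end

theory Submission
  imports Defs
begin

text \<open>
  A monomial outside \<open>J\<close> and inside \<open>I\<close> is recognised by its support, so \<open>I/J\<close> is described by a convex
  set \<open>P\<close> of subsets of the variables; \<open>F\<close>, \<open>B\<close>, \<open>C\<close> denote its members of size \<open>d\<close>, \<open>d + 1\<close>,
  \<open>d + 2\<close>. If the depth exceeds \<open>d + 1\<close>, then the Koszul homology of \<open>I/J\<close> vanishes in the top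
  degrees, which says that the kernel of the coboundary map from \<open>B\<close> to \<open>C\<close> is the image of \<open>F\<close>,
  and that the coboundary map from \<open>F\<close> stays injective on the subsets avoiding a given variable.

  Exactness is used like the nonvanishing of a minor: a member \<open>b\<close> of \<open>B\<close> not over \<open>F\<close> can be matched
  with some \<open>c\<close> over it such that deleting \<open>b\<close> and \<open>c\<close> preserves exactness; and if some \<open>c\<close> lies over
  exactly one member \<open>f\<close> of \<open>F\<close>, then the interval \<open>[f, c]\<close> can be deleted. For \<open>|F| \<le> 3\<close> such a
  \<open>c\<close> always exists, so these deletions exhaust \<open>F\<close> and \<open>B\<close>. They partition \<open>P\<close> into intervals whose
  tops have at least \<open>d + 2\<close> elements, i.e. give a Stanley decomposition showing that the Stanley
  depth is at least \<open>d + 2\<close>.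
\<close>

(* loops with associativity of multiplication, which it reverses *)
declare ideal.scale_scale [simp del]

text \<open>A count shows why exactness is the right invariant. An interval \<open>[f, p f]\<close>
  uses one member of \<open>F\<close>, two of \<open>B\<close> and one of \<open>C\<close>; an
  interval \<open>[b, m b]\<close> uses one of \<open>B\<close> and one of \<open>C\<close>. So
  disjoint intervals need |C| >= |B| - |F|, and this is the rank condition that \<open>cob\<close>
  from \<open>B\<close> to \<open>C\<close> has a kernel of dimension at most |F|. A minor controls
  only single pairs of \<open>b\<close> and \<open>c\<close>. The obstacle is an interval over
  \<open>f\<close>: two of its facets must share one top, and the interval must not meet one over
  another member of \<open>F\<close>. A \<open>c\<close> over exactly one member of \<open>F\<close>
  avoids that conflict, and its existence is where |F| <= 3 enters. The property
  \<open>vanish\<close> concerns \<open>F\<close> and \<open>B\<close> before any deletion; only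
  exactness is carried through the deletions.\<close>

subsection \<open>Cochains on subsets of the variables\<close>

text \<open>The usual incidence sign, for the arbitrary linear order on the variables given by
  \<open>to_nat\<close>.\<close>

definition inc :: "'n::finite \<Rightarrow> 'n set \<Rightarrow> 'k::comm_ring_1" where
  "inc j b = (-1) ^ card {k\<in>b. to_nat k < to_nat j}"

definition cob :: "('n::finite set \<Rightarrow> 'k::field) \<Rightarrow> 'n set \<Rightarrow> 'k" where
  "cob y c = (\<Sum>j\<in>c. inc j c * y (c - {j}))"

lemma inc_square: "inc j b * inc j b = 1"
  by (simp add: inc_def flip: power_mult_distrib)

lemma inc_nonzero [simp]: "inc j b \<noteq> 0"
  by (metis inc_square mult_zero_left zero_neq_one)

lemma inc_insert:
  "k \<notin> b \<Longrightarrow> inc j (insert k b) = (if to_nat k < to_nat j then - inc j b else inc j b)"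
proof -
  assume "k \<notin> b"
  have "{l \<in> insert k b. to_nat l < to_nat j} =
      (if to_nat k < to_nat j then insert k {l\<in>b. to_nat l < to_nat j} else {l\<in>b. to_nat l < to_nat j})"
    by auto
  then show ?thesis using \<open>k \<notin> b\<close>
    by (auto simp: inc_def)
qed

lemma inc_self: "inc j (insert j b) = inc j b"
  by (cases "j \<in> b") (auto simp: inc_insert insert_absorb)

text \<open>Deleting the smaller of \<open>i\<close> and \<open>j\<close> changes the sign attached
  to the larger one, and not conversely.\<close>

lemma inc_swap:
  assumes "i \<in> c" "j \<in> c" "i \<noteq> j"
  shows "inc i c * inc j (c - {i}) = - (inc j c * inc i (c - {j}) :: 'k::comm_ring_1)"
proof -
  define b where "b = c - {i, j}"
  have ij: "i \<notin> b" "j \<notin> b" and ci: "c - {i} = insert j b" and cj: "c - {j} = insert i b"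
    and c: "c = insert i (insert j b)" "c = insert j (insert i b)"
    using assms by (auto simp: b_def)
  have "inc i c = (inc i (insert j b) :: 'k)" unfolding c by (simp only: inc_self)
  moreover have "inc j c = (inc j (insert i b) :: 'k)" unfolding c(2) by (simp only: inc_self)
  moreover have "to_nat i \<noteq> to_nat j" using assms by simp
  ultimately show ?thesis unfolding ci cj
    using ij assms(3) by (auto simp: inc_insert inc_self)
qed

text \<open>The sum is split along the order of the indices. Exchanging them in the whole sum would
  only show that twice the sum is zero, which says nothing in characteristic 2.\<close>

lemma sum_antisym:
  fixes h :: "'n::finite \<Rightarrow> 'n \<Rightarrow> 'k::ring"
  assumes "\<And>i j. i \<in> c \<Longrightarrow> j \<in> c \<Longrightarrow> i \<noteq> j \<Longrightarrow> h i j = - h j i"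
  shows "(\<Sum>i\<in>c. \<Sum>j\<in>c - {i}. h i j) = 0"
proof -
  have "(\<Sum>i\<in>c. \<Sum>j\<in>c - {i}. h i j)
      = (\<Sum>i\<in>c. (\<Sum>j\<in>{j\<in>c. to_nat i < to_nat j}. h i j) + (\<Sum>j\<in>{j\<in>c. to_nat j < to_nat i}. h i j))"
  proof (rule sum.cong)
    fix i assume "i \<in> c"
    have eq: "c - {i} = {j\<in>c. to_nat i < to_nat j} \<union> {j\<in>c. to_nat j < to_nat i}"
      by auto (metis linorder_neqE_nat to_nat_split)
    show "(\<Sum>j\<in>c - {i}. h i j) =
        (\<Sum>j\<in>{j\<in>c. to_nat i < to_nat j}. h i j) + (\<Sum>j\<in>{j\<in>c. to_nat j < to_nat i}. h i j)"
      unfolding eq by (rule sum.union_disjoint) auto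
  qed simp
  also have "\<dots> = (\<Sum>i\<in>c. \<Sum>j\<in>{j\<in>c. to_nat i < to_nat j}. h i j)
      + (\<Sum>i\<in>c. \<Sum>j\<in>{j\<in>c. to_nat j < to_nat i}. h i j)"
    by (rule sum.distrib)
  also have "(\<Sum>i\<in>c. \<Sum>j\<in>{j\<in>c. to_nat j < to_nat i}. h i j)
      = (\<Sum>j\<in>c. \<Sum>i\<in>{i\<in>c. to_nat j < to_nat i}. h i j)"
    by (rule sum.swap_restrict) auto
  also have "\<dots> = (\<Sum>j\<in>c. \<Sum>i\<in>{i\<in>c. to_nat j < to_nat i}. - h j i)"
    by (intro sum.cong refl assms) auto
  also have "\<dots> = - (\<Sum>i\<in>c. \<Sum>j\<in>{j\<in>c. to_nat i < to_nat j}. h i j)"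
    by (simp add: sum_negf)
  finally show ?thesis by simp
qed

text \<open>
  The Koszul differential. Components are indexed by the complements of the customary index sets,
  so that \<open>cob\<close> is the part of \<open>kos var\<close> in squarefree degrees.
\<close>

definition kos :: "('n::finite \<Rightarrow> 'a::comm_ring_1) \<Rightarrow> ('n set \<Rightarrow> 'a) \<Rightarrow> 'n set \<Rightarrow> 'a" where
  "kos x y c = (\<Sum>j\<in>c. inc j c * x j * y (c - {j}))"

lemma kos_kos:
  fixes y :: "'n::finite set \<Rightarrow> 'a::comm_ring_1"
  shows "kos x (kos x y) c = 0"
proof -
  have "kos x (kos x y) c =
      (\<Sum>i\<in>c. \<Sum>j\<in>c - {i}. inc i c * inc j (c - {i}) * (x i * x j) * y (c - {i} - {j}))"
    unfolding kos_def sum_distrib_left by (simp only: mult_ac)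
  also have "\<dots> = 0"
  proof (rule sum_antisym)
    fix i j assume "i \<in> c" "j \<in> c" "i \<noteq> j"
    then have "inc i c * inc j (c - {i}) = - (inc j c * inc i (c - {j}) :: 'a)"
      by (rule inc_swap)
    moreover have "c - {i} - {j} = c - {j} - {i}" by auto
    ultimately show "inc i c * inc j (c - {i}) * (x i * x j) * y (c - {i} - {j})
        = - (inc j c * inc i (c - {j}) * (x j * x i) * y (c - {j} - {i}))"
      by (simp only: mult_minus_left mult.commute[of "x i" "x j"])
  qed
  finally show ?thesis .
qed

lemma cob_cob: "cob (cob y) c = 0"
  using kos_kos[of "\<lambda>_. 1" y c] by (simp add: kos_def cob_def)

lemma cob_zero: "(\<And>j. j \<in> c \<Longrightarrow> y (c - {j}) = 0) \<Longrightarrow> cob y c = 0"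
  by (simp add: cob_def)

lemma cob_single:
  assumes "w \<notin> f" "\<And>j. j \<in> f \<Longrightarrow> y (insert w f - {j}) = 0"
  shows "cob y (insert w f) = inc w f * y f"
proof -
  have "cob y (insert w f) = (\<Sum>j\<in>{w}. inc j (insert w f) * y (insert w f - {j}))"
    unfolding cob_def by (rule sum.mono_neutral_right) (use assms in auto)
  then show ?thesis using assms(1) by (simp add: inc_self)
qed

lemma cob_cong: "(\<And>j. j \<in> c \<Longrightarrow> y (c - {j}) = z (c - {j})) \<Longrightarrow> cob y c = cob z c"
  by (simp add: cob_def)

lemma cob_diff: "cob (\<lambda>b. y b - z b) c = cob y c - cob z c"
  unfolding cob_def right_diff_distrib by (rule sum_subtractf)

lemma cob_scale: "cob (\<lambda>b. a * y b) c = a * cob y c"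
  unfolding cob_def sum_distrib_left by (simp only: mult.left_commute)

lemma cob_sum: "cob (\<lambda>b. \<Sum>x\<in>X. y x b) c = (\<Sum>x\<in>X. cob (y x) c)"
  unfolding cob_def sum_distrib_left by (rule sum.swap)

subsection \<open>Matching the cochains of three consecutive levels\<close>

text \<open>
  \<open>F\<close>, \<open>B\<close>, \<open>C\<close> are the members of size \<open>d\<close>, \<open>d + 1\<close>, \<open>d + 2\<close> of the poset of supports of the
  monomials in \<open>I - J\<close>. The assumption \<open>vanish\<close> says that the cohomology in degree \<open>d\<close> of the part
  of the poset avoiding \<open>v\<close> is zero. The parameter \<open>field_type\<close> only records the coefficient
  field, over which cochains are quantified.
\<close>

locale three_levels =
  fixes F B C :: "'n::finite set set" and d :: nat and field_type :: "'k::field itself"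
  assumes card_F: "f \<in> F \<Longrightarrow> card f = d"
    and card_B: "b \<in> B \<Longrightarrow> card b = Suc d"
    and card_C: "c \<in> C \<Longrightarrow> card c = Suc (Suc d)"
    and convex: "f \<in> F \<Longrightarrow> c \<in> C \<Longrightarrow> f \<subseteq> b \<Longrightarrow> b \<subseteq> c \<Longrightarrow> card b = Suc d \<Longrightarrow> b \<in> B"
    and proper: "f \<in> F \<Longrightarrow> f \<noteq> UNIV"
    and vanish: "(\<And>f. f \<notin> F \<Longrightarrow> \<alpha> f = (0::'k)) \<Longrightarrow> (\<And>b. b \<in> B \<Longrightarrow> v \<notin> b \<Longrightarrow> cob \<alpha> b = 0) \<Longrightarrow>
      f \<in> F \<Longrightarrow> v \<notin> f \<Longrightarrow> \<alpha> f = 0"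
begin

definition above :: "'n set set \<Rightarrow> 'n set set" where
  "above F' = {b\<in>B. \<exists>f\<in>F'. f \<subseteq> b}"

text \<open>The equation for \<open>y\<close> is demanded on all of \<open>B\<close>, although
  \<open>y\<close> lives on \<open>B'\<close>. So the coboundary of \<open>\<alpha>\<close> is also
  known to vanish on members of \<open>B\<close> already deleted, and \<open>vanish\<close> can be
  applied to it.\<close>

definition exact :: "'n set set \<Rightarrow> 'n set set \<Rightarrow> 'n set set \<Rightarrow> bool" where
  "exact F' B' C' \<longleftrightarrow> (\<forall>y :: 'n set \<Rightarrow> 'k. (\<forall>b. b \<notin> B' \<longrightarrow> y b = 0) \<longrightarrow> (\<forall>c\<in>C'. cob y c = 0) \<longrightarrow>
     (\<exists>\<alpha>. (\<forall>f. f \<notin> F' \<longrightarrow> \<alpha> f = 0) \<and> (\<forall>b\<in>B. y b = cob \<alpha> b)))"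

lemma exactD:
  assumes "exact F' B' C'" "\<And>b. b \<notin> B' \<Longrightarrow> y b = 0" "\<And>c. c \<in> C' \<Longrightarrow> cob y c = (0::'k)"
  obtains \<alpha> where "\<And>f. f \<notin> F' \<Longrightarrow> \<alpha> f = 0" "\<And>b. b \<in> B \<Longrightarrow> y b = cob \<alpha> b"
proof -
  have "\<exists>\<alpha>. (\<forall>f. f \<notin> F' \<longrightarrow> \<alpha> f = 0) \<and> (\<forall>b\<in>B. y b = cob \<alpha> b)"
    using assms(1)[unfolded exact_def, rule_format, of y] assms(2,3) by blast
  then show ?thesis using that by blast
qed

section \<open>Members of \<open>F\<close> and their facets, that is, the members of
  \<open>B\<close> over them\<close>

lemma insert_of_subset:
  fixes f b :: "'n set"
  assumes "f \<subseteq> b" "card f = m" "card b = Suc m"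
  obtains w where "w \<notin> f" "b = insert w f"
proof -
  have "card (b - f) = 1" using assms by (simp add: card_Diff_subset)
  then obtain w where "b - f = {w}" by (auto simp: card_1_singleton_iff)
  then show ?thesis using assms(1) by (intro that[of w]) auto
qed

lemma F_eq: "f \<in> F \<Longrightarrow> f' \<in> F \<Longrightarrow> f \<subseteq> f' \<Longrightarrow> f = f'"
  by (simp add: card_F card_subset_eq)

lemma B_eq: "card b = Suc d \<Longrightarrow> card b' = Suc d \<Longrightarrow> b \<subseteq> b' \<Longrightarrow> b = (b' :: 'n set)"
  by (simp add: card_subset_eq)

lemma union_eq:
  assumes "f \<in> F" "f' \<in> F" "f \<noteq> f'" "f \<subseteq> b" "f' \<subseteq> b" "card b = Suc d"
  shows "b = f \<union> f'"
proof -
  have "f \<subset> f \<union> f'" using F_eq[of f' f] assms by auto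
  then have "d < card (f \<union> f')" using card_F[OF assms(1)] psubset_card_mono[of "f \<union> f'" f] by simp
  then show ?thesis using card_seteq[of b "f \<union> f'"] assms by auto
qed

lemma union_not_level:
  assumes "f \<in> F" "f' \<in> F" "f \<noteq> f'"
  shows "d < card (f \<union> f')"
proof -
  have "f \<subset> f \<union> f'" using F_eq[of f' f] assms by auto
  then show ?thesis using card_F[OF assms(1)] psubset_card_mono[of "f \<union> f'" f] by simp
qed

lemma cob_unique:
  fixes \<alpha> :: "'n set \<Rightarrow> 'k"
  assumes "\<And>f. f \<notin> F' \<Longrightarrow> \<alpha> f = 0" "\<And>g. g \<in> F' \<Longrightarrow> g \<subseteq> insert w f \<Longrightarrow> g = f" "w \<notin> f"
  shows "cob \<alpha> (insert w f) = inc w f * \<alpha> f"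
proof (rule cob_single[OF assms(3)])
  fix j assume "j \<in> f"
  then have "insert w f - {j} \<noteq> f" by auto
  moreover have "insert w f - {j} \<subseteq> insert w f" by auto
  ultimately show "\<alpha> (insert w f - {j}) = 0" using assms(1,2) by blast
qed

lemma cob_not_above:
  fixes \<alpha> :: "'n set \<Rightarrow> 'k"
  assumes "\<And>f. f \<notin> F' \<Longrightarrow> \<alpha> f = 0" "\<And>g. g \<in> F' \<Longrightarrow> \<not> g \<subseteq> b"
  shows "cob \<alpha> b = 0"
  by (rule cob_zero) (use assms in blast)

text \<open>If every facet of \<open>f\<close> contained \<open>v\<close>, the indicator of
  \<open>f\<close> would contradict \<open>vanish\<close> at \<open>v\<close>.\<close>

lemma other_facet:
  assumes "f \<in> F" "v \<notin> f"
  obtains w where "w \<notin> f" "w \<noteq> v" "insert w f \<in> B"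
proof -
  have "\<exists>b\<in>B. v \<notin> b \<and> f \<subseteq> b"
  proof (rule ccontr)
    assume "\<not> ?thesis"
    moreover define \<alpha> :: "'n set \<Rightarrow> 'k" where "\<alpha> = (\<lambda>g. if g = f then 1 else 0)"
    ultimately have "cob \<alpha> b = 0" if "b \<in> B" "v \<notin> b" for b
      using that by (intro cob_not_above[of "{f}"]) auto
    with assms have "\<alpha> f = 0" by (intro vanish[of \<alpha> v f]) (auto simp: \<alpha>_def)
    then show False by (simp add: \<alpha>_def)
  qed
  then obtain b where b: "b \<in> B" "v \<notin> b" "f \<subseteq> b" by blast
  obtain w where "w \<notin> f" "b = insert w f"
    using insert_of_subset[OF b(3) card_F[OF assms(1)] card_B[OF b(1)]] by blast
  then show ?thesis using that b by blast
qed

lemma cob_pair: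
  fixes y :: "'n set \<Rightarrow> 'k"
  assumes "w \<notin> f" "v \<notin> g" "insert w f = b" "insert v g = b" "f \<noteq> g"
    and "\<And>h. h \<subseteq> b \<Longrightarrow> h \<noteq> f \<Longrightarrow> h \<noteq> g \<Longrightarrow> y h = 0"
  shows "cob y b = inc w b * y f + inc v b * y g"
proof -
  have f: "b - {w} = f" and g: "b - {v} = g" using assms by auto
  then have "w \<noteq> v" using assms by auto
  have "cob y b = (\<Sum>j\<in>{w, v}. inc j b * y (b - {j}))"
    unfolding cob_def
  proof (rule sum.mono_neutral_right)
    show "\<forall>j\<in>b - {w, v}. inc j b * y (b - {j}) = 0"
    proof
      fix j assume j: "j \<in> b - {w, v}"
      then have "b - {j} \<noteq> f" "b - {j} \<noteq> g" using f g by auto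
      then show "inc j b * y (b - {j}) = 0" using assms(6)[of "b - {j}"] by auto
    qed
  qed (use assms in auto)
  then show ?thesis using \<open>w \<noteq> v\<close> f g by simp
qed

text \<open>The ratio depends only on the two signs in \<open>b\<close>, so one
  \<open>\<kappa>\<close> serves for every \<open>y\<close>. It is used to choose functions on
  \<open>F\<close> whose coboundary cancels on a common facet.\<close>

lemma cancel_pair:
  assumes "f \<in> F" "g \<in> F" "f \<noteq> g" "f \<subseteq> b" "g \<subseteq> b" "card b = Suc d"
  obtains \<kappa> :: 'k where "\<kappa> \<noteq> 0"
    "\<And>y. (\<And>h. h \<subseteq> b \<Longrightarrow> h \<noteq> f \<Longrightarrow> h \<noteq> g \<Longrightarrow> y h = 0) \<Longrightarrow> y g = \<kappa> * y f \<Longrightarrow> cob y b = 0"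
proof -
  obtain w where w: "w \<notin> f" "b = insert w f"
    using insert_of_subset[OF assms(4) card_F[OF assms(1)] assms(6)] by blast
  obtain v where v: "v \<notin> g" "b = insert v g"
    using insert_of_subset[OF assms(5) card_F[OF assms(2)] assms(6)] by blast
  define \<kappa> :: 'k where "\<kappa> = - inc w b / inc v b"
  show ?thesis
  proof (rule that[of \<kappa>])
    fix y :: "'n set \<Rightarrow> 'k"
    assume y: "\<And>h. h \<subseteq> b \<Longrightarrow> h \<noteq> f \<Longrightarrow> h \<noteq> g \<Longrightarrow> y h = 0" "y g = \<kappa> * y f"
    have "cob y b = inc w b * y f + inc v b * y g"
      by (rule cob_pair[OF w(1) v(1) _ _ assms(3)]) (use w v y in auto)
    then show "cob y b = 0" using y(2) by (simp add: \<kappa>_def)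
  qed (simp add: \<kappa>_def)
qed

text \<open>
  If no member of \<open>C'\<close> lies over exactly one member of \<open>F'\<close>, then the part of \<open>cob r\<close> on the sets
  containing \<open>w\<close> is itself a cocycle, hence a coboundary, and \<open>vanish\<close> shows that it is zero.
\<close>

lemma coefficient_vanishes:
  fixes r :: "'n set \<Rightarrow> 'k"
  assumes sub: "F' \<subseteq> F" "C' \<subseteq> C" and ex: "exact F' (above F') C'"
    and nopriv: "\<And>c f. c \<in> C' \<Longrightarrow> f \<in> F' \<Longrightarrow> f \<subseteq> c \<Longrightarrow> \<exists>g\<in>F'. g \<noteq> f \<and> g \<subseteq> c"
    and r: "\<And>f. f \<notin> F' \<Longrightarrow> r f = 0"
    and inner: "\<And>b f g. b \<in> B \<Longrightarrow> f \<in> F' \<Longrightarrow> g \<in> F' \<Longrightarrow> f \<noteq> g \<Longrightarrow> f \<subseteq> b \<Longrightarrow> g \<subseteq> b \<Longrightarrow> cob r b = 0"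
    and w: "w \<notin> \<Union>F'" "f \<in> F'" "insert w f \<in> B"
  shows "r f = 0"
proof -
  define y where "y b = (if b \<in> B \<and> w \<in> b then cob r b else 0)" for b
  have supp: "y b = 0" if "b \<notin> above F'" for b
    using that cob_not_above[of F' r b, OF r] by (auto simp: y_def above_def)
  have cocycle: "cob y c = 0" if c: "c \<in> C'" for c
  proof (cases "w \<in> c \<and> (\<exists>f\<in>F'. f \<subseteq> c)")
    case True
    then obtain f where f: "f \<in> F'" "f \<subseteq> c" by blast
    obtain g where "g \<in> F'" "g \<noteq> f" "g \<subseteq> c"
      using nopriv[OF c f] by blast
    note fg = f(1) this(1,2) f(2) this(3)
    have cC: "c \<in> C" using c sub by blast
    have cw: "card (c - {w}) = Suc d" using card_C[OF cC] True by simp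
    have sub_cw: "f \<subseteq> c - {w}" "g \<subseteq> c - {w}" using fg w(1) by auto
    have inB: "b \<in> B" if "h \<in> F'" "h \<subseteq> b" "b \<subseteq> c" "card b = Suc d" for h b
      using convex[of h c b] that cC sub by blast
    \<comment> \<open>Two members lie below \<open>c - {w}\<close>, so it is a common facet, and the
      value zero that \<open>y\<close> has there agrees with \<open>cob r\<close>.\<close>
    have "cob r (c - {w}) = 0"
      by (rule inner[OF inB[OF fg(1) sub_cw(1) _ cw] fg(1,2)]) (use fg sub_cw in auto)
    have "y (c - {j}) = cob r (c - {j})" if j: "j \<in> c" for j
    proof (cases "j = w")
      case False
      show ?thesis
      proof (cases "\<exists>h\<in>F'. h \<subseteq> c - {j}")
        case True
        have "card (c - {j}) = Suc d" using card_C[OF cC] j by simp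
        with True have "c - {j} \<in> B" using inB by blast
        then show ?thesis using False \<open>w \<in> c \<and> _\<close> by (simp add: y_def)
      next
        case False
        then show ?thesis using cob_not_above[of F' r "c - {j}", OF r] by (auto simp: y_def)
      qed
    qed (use \<open>cob r (c - {w}) = 0\<close> in \<open>simp add: y_def\<close>)
    then have "cob y c = cob (cob r) c" by (rule cob_cong)
    then show ?thesis by (simp only: cob_cob)
  next
    case False
    show ?thesis
    proof (rule cob_zero)
      fix j assume "j \<in> c"
      show "y (c - {j}) = 0"
      proof (cases "w \<in> c")
        case True
        then have "\<not> h \<subseteq> c - {j}" if "h \<in> F'" for h using that False by blast
        then show ?thesis using cob_not_above[of F' r "c - {j}", OF r] by (auto simp: y_def)
      qed (simp add: y_def)
    qed
  qed
  obtain \<alpha> where \<alpha>: "\<And>f. f \<notin> F' \<Longrightarrow> \<alpha> f = 0" "\<And>b. b \<in> B \<Longrightarrow> y b = cob \<alpha> b"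
    using exactD[OF ex, of y] supp cocycle by blast
  \<comment> \<open>On the sets that avoid \<open>w\<close>, \<open>y\<close> is zero, and so is the
    coboundary of \<open>\<alpha>\<close> on those in \<open>B\<close>. No member of
    \<open>F'\<close> contains \<open>w\<close>, so \<open>vanish\<close> at \<open>w\<close>
    reaches all of them.\<close>
  have "\<alpha> g = 0" for g
  proof (cases "g \<in> F'")
    case True
    show ?thesis
    proof (rule vanish[of \<alpha> w g])
      show "\<alpha> f = 0" if "f \<notin> F" for f using \<alpha>(1) that sub by blast
      show "cob \<alpha> b = 0" if "b \<in> B" "w \<notin> b" for b using \<alpha>(2)[OF that(1)] that by (simp add: y_def)
    qed (use True sub w in auto)
  qed (rule \<alpha>(1))
  then have "cob r (insert w f) = 0"
    using \<alpha>(2)[OF w(3)] w(3) by (simp add: y_def cob_def)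
  moreover have "cob r (insert w f) = inc w f * r f"
  proof (rule cob_unique[of F'])
    show "g = f" if "g \<in> F'" "g \<subseteq> insert w f" for g
      using that w sub F_eq[of g f] by blast
  qed (use r w in auto)
  ultimately show ?thesis by simp
qed

text \<open>Up to sign both values are the coefficient \<open>\<alpha> f\<close>. The lemma refutes
  exactness by a cocycle that is nonzero on only one of the two facets.\<close>

lemma both_facets:
  fixes y :: "'n set \<Rightarrow> 'k"
  assumes "exact F' B' C'" "\<And>b. b \<notin> B' \<Longrightarrow> y b = 0" "\<And>c. c \<in> C' \<Longrightarrow> cob y c = 0"
    and "w \<notin> f" "insert w f \<in> B" "\<And>g. g \<in> F' \<Longrightarrow> g \<subseteq> insert w f \<Longrightarrow> g = f"
    and "v \<notin> f" "insert v f \<in> B" "\<And>g. g \<in> F' \<Longrightarrow> g \<subseteq> insert v f \<Longrightarrow> g = f"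
    and "y (insert w f) \<noteq> 0"
  shows "y (insert v f) \<noteq> 0"
proof -
  obtain \<alpha> where \<alpha>: "\<And>f. f \<notin> F' \<Longrightarrow> \<alpha> f = 0" "\<And>b. b \<in> B \<Longrightarrow> y b = cob \<alpha> b"
    using exactD[OF assms(1), of y] assms(2,3) by blast
  have "y (insert w f) = inc w f * \<alpha> f" "y (insert v f) = inc v f * \<alpha> f"
    using \<alpha>(2)[OF assms(5)] \<alpha>(2)[OF assms(8)] cob_unique[OF \<alpha>(1) assms(6,4)]
      cob_unique[OF \<alpha>(1) assms(9,7)] by simp_all
  then show ?thesis using assms(10) by auto
qed

definition delta :: "'n set \<Rightarrow> 'n set \<Rightarrow> 'k" where
  "delta b = (\<lambda>x. if x = b then 1 else 0)"

lemma cob_delta_zero: "\<not> b \<subseteq> c \<Longrightarrow> cob (delta b) c = 0"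
  by (rule cob_zero) (auto simp: delta_def)

lemma cob_delta_nonzero:
  assumes "b \<subseteq> c" "card b = m" "card c = Suc m"
  shows "cob (delta b) c \<noteq> 0"
proof -
  obtain w where w: "w \<notin> b" "c = insert w b" using insert_of_subset[OF assms] by blast
  have "cob (delta b) c = inc w b * delta b b"
    unfolding w(2) by (rule cob_single[OF w(1)]) (use w(1) in \<open>auto simp: delta_def\<close>)
  then show ?thesis by (simp add: delta_def)
qed

lemma two_facets:
  assumes "f \<in> F"
  obtains w v where "w \<notin> f" "v \<notin> f" "w \<noteq> v" "insert w f \<in> B" "insert v f \<in> B"
proof -
  obtain u where "u \<notin> f" using proper[OF assms] by blast
  then obtain w where w: "w \<notin> f" "insert w f \<in> B" using other_facet[OF assms] by blast
  then show ?thesis using other_facet[OF assms w(1)] that by metis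
qed

section \<open>Existence of a \<open>c\<close> over exactly one member of \<open>F'\<close>\<close>

definition has_private :: "'n set set \<Rightarrow> 'n set set \<Rightarrow> bool" where
  "has_private F' C' \<longleftrightarrow> (\<exists>f\<in>F'. \<exists>c\<in>C'. f \<subseteq> c \<and> (\<forall>g\<in>F'. g \<subseteq> c \<longrightarrow> g = f))"

lemma not_privateD:
  "\<not> has_private F' C' \<Longrightarrow> c \<in> C' \<Longrightarrow> f \<in> F' \<Longrightarrow> f \<subseteq> c \<Longrightarrow> \<exists>g\<in>F'. g \<noteq> f \<and> g \<subseteq> c"
  unfolding has_private_def by metis

text \<open>With no \<open>c\<close> over \<open>f\<close>, the unit vector at one facet of
  \<open>f\<close> is a cocycle, but \<open>f\<close> has a second facet, where it is zero.\<close>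

lemma private_one:
  assumes "f \<in> F" "C' \<subseteq> C" "exact {f} (above {f}) C'"
  shows "has_private {f} C'"
proof (rule ccontr)
  assume "\<not> ?thesis"
  then have no: "\<not> f \<subseteq> c" if "c \<in> C'" for c using that by (auto simp: has_private_def)
  obtain w v where wv: "w \<notin> f" "v \<notin> f" "w \<noteq> v" "insert w f \<in> B" "insert v f \<in> B"
    using two_facets[OF assms(1)] .
  have "delta (insert w f) (insert v f) \<noteq> 0"
  proof (rule both_facets[OF assms(3)])
    show "cob (delta (insert w f)) c = 0" if "c \<in> C'" for c
      using no[OF that] by (intro cob_delta_zero) auto
  qed (use wv in \<open>auto simp: delta_def above_def\<close>)
  then show False using wv by (auto simp: delta_def split: if_splits)
qed

text \<open>If each \<open>c\<close> over one of \<open>f\<close>, \<open>g\<close> is over both,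
  \<open>coefficient_vanishes\<close> forces all their facets into \<open>f \<union> g\<close>. This
  union then has at least d + 2 elements and is the only possible \<open>c\<close>. One linear
  condition is too little to exclude a cocycle that violates \<open>both_facets\<close>.\<close>

lemma private_two:
  assumes fg: "f \<in> F" "g \<in> F" "f \<noteq> g" and C': "C' \<subseteq> C" and ex: "exact {f, g} (above {f, g}) C'"
  shows "has_private {f, g} C'"
proof (rule ccontr)
  assume npriv: "\<not> ?thesis"
  have nopriv: "f \<subseteq> c \<longleftrightarrow> g \<subseteq> c" if "c \<in> C'" for c
    using that npriv by (auto simp: has_private_def)
  have "\<exists>r :: 'n set \<Rightarrow> 'k. r f \<noteq> 0 \<and> r g \<noteq> 0 \<and> (\<forall>h. h \<notin> {f, g} \<longrightarrow> r h = 0) \<and>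
      (\<forall>b\<in>B. f \<subseteq> b \<and> g \<subseteq> b \<longrightarrow> cob r b = 0)"
  proof (cases "\<exists>b\<in>B. f \<subseteq> b \<and> g \<subseteq> b")
    case True
    then obtain b where b: "b \<in> B" "f \<subseteq> b" "g \<subseteq> b" by blast
    obtain \<kappa> :: 'k where \<kappa>: "\<kappa> \<noteq> 0" "\<And>y. (\<And>h. h \<subseteq> b \<Longrightarrow> h \<noteq> f \<Longrightarrow> h \<noteq> g \<Longrightarrow> y h = 0) \<Longrightarrow>
        y g = \<kappa> * y f \<Longrightarrow> cob y b = 0"
      using cancel_pair[OF fg b(2,3) card_B[OF b(1)]] by blast
    have "b' = b" if "b' \<in> B" "f \<subseteq> b'" "g \<subseteq> b'" for b'
      using union_eq[OF fg b(2,3) card_B[OF b(1)]] union_eq[OF fg that(2,3) card_B[OF that(1)]] by simp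
    moreover have "cob (\<lambda>h. if h = f then 1 else if h = g then \<kappa> else 0) b = 0"
      by (rule \<kappa>(2)) (use fg in auto)
    ultimately show ?thesis using \<kappa>(1) fg
      by (intro exI[of _ "\<lambda>h. if h = f then 1 else if h = g then \<kappa> else 0"]) auto
  next
    case False
    then show ?thesis by (intro exI[of _ "\<lambda>h. if h \<in> {f, g} then 1 else 0"]) auto
  qed
  then obtain r :: "'n set \<Rightarrow> 'k" where r0: "r f \<noteq> 0 \<and> r g \<noteq> 0 \<and>
      (\<forall>h. h \<notin> {f, g} \<longrightarrow> r h = 0) \<and> (\<forall>b\<in>B. f \<subseteq> b \<and> g \<subseteq> b \<longrightarrow> cob r b = 0)" ..
  have r: "r f \<noteq> 0" "r g \<noteq> 0" "\<And>h. h \<notin> {f, g} \<Longrightarrow> r h = 0"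
    "\<And>b. b \<in> B \<Longrightarrow> f \<subseteq> b \<Longrightarrow> g \<subseteq> b \<Longrightarrow> cob r b = 0" using r0 by simp_all
  have outer: "insert w h \<notin> B" if "w \<notin> f \<union> g" "h \<in> {f, g}" for w h
  proof
    assume w: "insert w h \<in> B"
    have "r h = 0"
    proof (rule coefficient_vanishes[OF _ C' ex])
      show "\<exists>b\<in>{f, g}. b \<noteq> a \<and> b \<subseteq> c" if "c \<in> C'" "a \<in> {f, g}" "a \<subseteq> c" for c a
        using nopriv[OF that(1)] that fg by auto
      show "cob r b = 0" if "b \<in> B" "a \<in> {f, g}" "a' \<in> {f, g}" "a \<noteq> a'" "a \<subseteq> b" "a' \<subseteq> b" for b a a'
        using r(4)[OF that(1)] that by auto
    qed (use that w fg r in auto)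
    then show False using that r by auto
  qed
  obtain w v where wv: "w \<notin> f" "v \<notin> f" "w \<noteq> v" "insert w f \<in> B" "insert v f \<in> B"
    using two_facets[OF fg(1)] .
  obtain w' v' where wv': "w' \<notin> g" "v' \<notin> g" "w' \<noteq> v'" "insert w' g \<in> B" "insert v' g \<in> B"
    using two_facets[OF fg(2)] .
  have in_g: "w \<in> g" "v \<in> g" using outer wv by blast+
  have in_f: "w' \<in> f" "v' \<in> f" using outer wv' by blast+
  have nog: "\<not> g \<subseteq> insert x f" for x using in_g wv by auto
  have nof: "\<not> f \<subseteq> insert x g" for x using in_f wv' by auto
  have only: "c = f \<union> g" if c: "c \<in> C'" and "f \<subseteq> c \<or> g \<subseteq> c" for c
  proof -
    have sub: "f \<union> g \<subseteq> c" using that nopriv by blast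
    have "insert w (insert v f) \<subseteq> f \<union> g" using in_g by auto
    then have "card (insert w (insert v f)) \<le> card (f \<union> g)" by (simp add: card_mono)
    then have "Suc (Suc d) \<le> card (f \<union> g)" using wv card_F[OF fg(1)] by simp
    then show ?thesis using card_seteq[OF _ sub] card_C[of c] c C' by auto
  qed
  define p where "p = cob (delta (insert w f)) (f \<union> g)"
  define q where "q = cob (delta (insert w' g)) (f \<union> g)"
  have zero: "cob (delta (insert w f)) c = 0" "cob (delta (insert w' g)) c = 0"
    if "c \<in> C'" "c \<noteq> f \<union> g" for c
    using only[OF that(1)] that(2) by (auto intro!: cob_delta_zero)
  show False
  \<comment> \<open>If \<open>f \<union> g\<close> has more than d + 2 elements, \<open>p\<close> is
    zero and nothing in \<open>C'\<close> lies over \<open>f\<close>. Otherwise \<open>q / p\<close>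
    times the unit vector at a facet of \<open>f\<close> cancels, at \<open>f \<union> g\<close>,
    the one at a facet of \<open>g\<close>.\<close>
  proof (cases "p = 0")
    case True
    have "delta (insert w f) (insert v f) \<noteq> 0"
    proof (rule both_facets[OF ex])
      show "cob (delta (insert w f)) c = 0" if "c \<in> C'" for c
        using zero(1)[OF that] True by (cases "c = f \<union> g") (auto simp: p_def)
    qed (use wv nog in \<open>auto simp: delta_def above_def\<close>)
    then show False using wv by (auto simp: delta_def split: if_splits)
  next
    case False
    define y where "y = (\<lambda>b. delta (insert w' g) b - (q / p) * delta (insert w f) b)"
    have "insert w f \<noteq> insert w' g" "insert w f \<noteq> insert v' g" using nog by blast+
    then have yv: "y (insert w' g) = 1" "y (insert v' g) = 0"
      using wv' by (auto simp: y_def delta_def)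
    have "y (insert v' g) \<noteq> 0"
    proof (rule both_facets[OF ex])
      show "cob y c = 0" if "c \<in> C'" for c
      proof (cases "c = f \<union> g")
        case True
        then show ?thesis using False unfolding y_def cob_diff cob_scale by (simp add: p_def q_def)
      next
        case False
        show ?thesis unfolding y_def cob_diff cob_scale using zero[OF that False] by simp
      qed
      show "y b = 0" if "b \<notin> above {f, g}" for b
        using that wv wv' by (auto simp: y_def delta_def above_def)
    qed (use wv' nof yv in auto)
    then show False using yv by simp
  qed
qed

text \<open>
  Here \<open>f\<close> has no common facet with the other members of \<open>F'\<close>. The at most two members of \<open>C'\<close>
  over \<open>f\<close> then already lie in the image of the facets of \<open>f\<close>, so they can be given up.
\<close>

lemma exact_remove_isolated:
  assumes fgh: "f \<in> F" "g \<in> F" "h \<in> F" "f \<noteq> g" "f \<noteq> h" "g \<noteq> h" and C': "C' \<subseteq> C"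
    and ex: "exact {f, g, h} (above {f, g, h}) C'"
    and nopriv: "\<And>c. c \<in> C' \<Longrightarrow> f \<subseteq> c \<Longrightarrow> g \<subseteq> c \<or> h \<subseteq> c"
    and isolated: "\<And>b. b \<in> B \<Longrightarrow> f \<subseteq> b \<Longrightarrow> \<not> g \<subseteq> b \<and> \<not> h \<subseteq> b"
  shows "exact {g, h} (above {g, h}) {c\<in>C'. \<not> f \<subseteq> c}"
proof -
  define G where "G = {c\<in>C'. f \<subseteq> c}"
  have union: "c = f \<union> k" if c: "c \<in> C'" "f \<subseteq> c" "k \<subseteq> c" and k: "k = g \<or> k = h" for c k
  proof -
    have cC: "c \<in> C" using c C' by blast
    have kF: "k \<in> F" "f \<noteq> k" using k fgh by auto
    \<comment> \<open>A common facet is excluded by \<open>isolated\<close>, so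
      \<open>f \<union> k\<close> already has the d + 2 elements of \<open>c\<close>.\<close>
    have "card (f \<union> k) \<noteq> Suc d"
    proof
      assume "card (f \<union> k) = Suc d"
      then have "f \<union> k \<in> B" using convex[OF fgh(1) cC] c by auto
      then show False using isolated k by blast
    qed
    then have "Suc (Suc d) \<le> card (f \<union> k)" using union_not_level[OF fgh(1) kF] by simp
    then show ?thesis using card_seteq[of c "f \<union> k"] card_C[OF cC] c by auto
  qed
  have G: "G \<subseteq> {f \<union> g, f \<union> h}"
  proof
    fix c assume "c \<in> G"
    then have c: "c \<in> C'" "f \<subseteq> c" by (auto simp: G_def)
    then show "c \<in> {f \<union> g, f \<union> h}" using union[OF c, of g] union[OF c, of h] nopriv[OF c] by blast
  qed
  \<comment> \<open>Each \<open>c\<close> over \<open>f\<close> has a facet of \<open>f\<close>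
    below it alone: of two distinct sets of the same size, each has an element outside the
    other.\<close>
  have "\<exists>b. b \<in> B \<and> f \<subseteq> b \<and> b \<subseteq> c \<and> (\<forall>c'\<in>G. b \<subseteq> c' \<longrightarrow> c' = c)" if c: "c \<in> G" for c
  proof -
    have cC: "c \<in> C" "f \<subseteq> c" using c C' by (auto simp: G_def)
    define c' where "c' = (if c = f \<union> g then f \<union> h else f \<union> g)"
    have "\<exists>j\<in>c - f. c' \<in> G \<longrightarrow> c' \<noteq> c \<longrightarrow> j \<notin> c'"
    proof (cases "c' \<in> G \<and> c' \<noteq> c")
      case True
      then have "c' \<in> C" "f \<subseteq> c'" using C' by (auto simp: G_def)
      have "\<not> c \<subseteq> c'"
        using card_seteq[of c' c] card_C[OF cC(1)] card_C[OF \<open>c' \<in> C\<close>] True by auto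
      then show ?thesis using \<open>f \<subseteq> c'\<close> by auto
    next
      case False
      have "\<not> c \<subseteq> f" using card_mono[of f c] card_F[OF fgh(1)] card_C[OF cC(1)] by auto
      then show ?thesis using False by auto
    qed
    then obtain j where j: "j \<in> c" "j \<notin> f" "c' \<in> G \<Longrightarrow> c' \<noteq> c \<Longrightarrow> j \<notin> c'" by blast
    have "insert j f \<in> B"
      by (rule convex[OF fgh(1) cC(1)]) (use j cC card_F[OF fgh(1)] in auto)
    moreover have "e = c" if "e \<in> G" "insert j f \<subseteq> e" for e
    proof (rule ccontr)
      assume "e \<noteq> c"
      moreover have "e \<in> {f \<union> g, f \<union> h}" "c \<in> {f \<union> g, f \<union> h}" using that G c by blast+
      ultimately have "e = c'" unfolding c'_def by (elim insertE emptyE) simp_all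
      then show False using j(3) that \<open>e \<noteq> c\<close> by blast
    qed
    ultimately show ?thesis using j cC by (intro exI[of _ "insert j f"]) auto
  qed
  then obtain facet where facet: "\<And>c. c \<in> G \<Longrightarrow> facet c \<in> B" "\<And>c. c \<in> G \<Longrightarrow> f \<subseteq> facet c"
    "\<And>c. c \<in> G \<Longrightarrow> facet c \<subseteq> c" "\<And>c c'. c \<in> G \<Longrightarrow> c' \<in> G \<Longrightarrow> facet c \<subseteq> c' \<Longrightarrow> c' = c"
    by metis
  show ?thesis
    unfolding exact_def
  proof (intro allI impI)
    fix y :: "'n set \<Rightarrow> 'k"
    assume supp: "\<forall>b. b \<notin> above {g, h} \<longrightarrow> y b = 0"
      and coc: "\<forall>c\<in>{c \<in> C'. \<not> f \<subseteq> c}. cob y c = 0"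
    \<comment> \<open>Each chosen facet affects only its own \<open>c\<close> in \<open>C'\<close>,
      so these multiples close \<open>z\<close> at the members of \<open>C'\<close> over
      \<open>f\<close> and change nothing at the others.\<close>
    define s where "s c = cob y c / cob (delta (facet c)) c" for c
    define z where "z = (\<lambda>b. y b - (\<Sum>c\<in>G. s c * delta (facet c) b))"
    have zero: "cob (delta (facet c)) c' = 0" if "c \<in> G" "c' \<in> C'" "c' \<noteq> c" for c c'
    proof (rule cob_delta_zero)
      show "\<not> facet c \<subseteq> c'"
      proof
        assume sub: "facet c \<subseteq> c'"
        then have "c' \<in> G" using facet(2)[OF that(1)] that by (simp add: G_def)
        then show False using facet(4)[OF that(1) _ sub] that by simp
      qed
    qed
    have cob_z: "cob z c = 0" if c: "c \<in> C'" for c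
    proof (cases "f \<subseteq> c")
      case True
      then have cG: "c \<in> G" using c by (simp add: G_def)
      have "(\<Sum>c'\<in>G. s c' * cob (delta (facet c')) c) = (\<Sum>c'\<in>{c}. s c' * cob (delta (facet c')) c)"
        by (rule sum.mono_neutral_right) (use cG zero c in auto)
      moreover have "cob (delta (facet c)) c \<noteq> 0"
        using cob_delta_nonzero[OF facet(3)[OF cG] card_B[OF facet(1)[OF cG]]] card_C c C' by blast
      ultimately show ?thesis
        unfolding z_def cob_diff cob_sum cob_scale by (simp add: s_def)
    next
      case False
      then have "c \<notin> G" by (simp add: G_def)
      then have "(\<Sum>c'\<in>G. s c' * cob (delta (facet c')) c) = 0"
        using zero c by (intro sum.neutral) auto
      then show ?thesis
        unfolding z_def cob_diff cob_sum cob_scale using coc c False by simp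
    qed
    have off: "(\<Sum>c\<in>G. s c * delta (facet c) b) = 0" if "\<not> f \<subseteq> b \<or> b \<notin> B" for b
      using that facet(1,2) by (intro sum.neutral) (auto simp: delta_def)
    have supp_z: "z b = 0" if "b \<notin> above {f, g, h}" for b
    proof -
      have "\<not> f \<subseteq> b \<or> b \<notin> B" "b \<notin> above {g, h}" using that by (auto simp: above_def)
      then show ?thesis using off supp by (simp add: z_def)
    qed
    obtain \<alpha> where \<alpha>: "\<And>a. a \<notin> {f, g, h} \<Longrightarrow> \<alpha> a = 0" "\<And>b. b \<in> B \<Longrightarrow> z b = cob \<alpha> b"
      using exactD[OF ex, of z] supp_z cob_z by blast
    define \<beta> where "\<beta> = \<alpha>(f := 0)"
    have \<beta>: "\<beta> a = 0" if "a \<notin> {g, h}" for a using \<alpha>(1)[of a] that by (auto simp: \<beta>_def)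
    have "y b = cob \<beta> b" if b: "b \<in> B" for b
    proof (cases "f \<subseteq> b")
      case True
      then have no: "\<not> g \<subseteq> b" "\<not> h \<subseteq> b" using isolated b by blast+
      then have "cob \<beta> b = 0" by (intro cob_not_above[of "{g, h}" \<beta>, OF \<beta>]) auto
      moreover have "y b = 0" using supp no by (auto simp: above_def)
      ultimately show ?thesis by simp
    next
      case False
      then have "y b = z b" using off by (simp add: z_def)
      also have "\<dots> = cob \<alpha> b" using \<alpha>(2) b .
      also have "\<dots> = cob \<beta> b" using False by (intro cob_cong) (auto simp: \<beta>_def)
      finally show ?thesis .
    qed
    then show "\<exists>\<alpha>. (\<forall>f. f \<notin> {g, h} \<longrightarrow> \<alpha> f = 0) \<and> (\<forall>b\<in>B. y b = cob \<alpha> b)" using \<beta> by blast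
  qed
qed

text \<open>
  Some \<open>r\<close> on \<open>{f, g, h}\<close> without zeros cancels on all common facets (if \<open>f\<close>, \<open>g\<close>, \<open>h\<close> lie in one
  common facet, two nonzero values suffice). So by \<open>coefficient_vanishes\<close> all facets lie in
  \<open>f \<union> g \<union> h\<close>, and the few that are left contradict \<open>vanish\<close> at the element of \<open>f - g\<close>.
\<close>

lemma private_path:
  assumes fgh: "f \<in> F" "g \<in> F" "h \<in> F" "f \<noteq> g" "f \<noteq> h" "g \<noteq> h" and C': "C' \<subseteq> C"
    and ex: "exact {f, g, h} (above {f, g, h}) C'"
    and B: "f \<union> g \<in> B" "g \<union> h \<in> B"
  shows "has_private {f, g, h} C'"
proof (rule ccontr)
  assume npriv: "\<not> ?thesis"
  note nopriv = not_privateD[OF npriv]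
  have sub: "{f, g, h} \<subseteq> F" using fgh by auto
  obtain x where x: "x \<notin> g" "f \<union> g = insert x g"
    using insert_of_subset[of g "f \<union> g", OF _ card_F[OF fgh(2)] card_B[OF B(1)]] by auto
  obtain x' where x': "x' \<notin> g" "g \<union> h = insert x' g"
    using insert_of_subset[of g "g \<union> h", OF _ card_F[OF fgh(2)] card_B[OF B(2)]] by auto
  obtain \<kappa> :: 'k where \<kappa>: "\<kappa> \<noteq> 0"
    "\<And>y. (\<And>a. a \<subseteq> f \<union> g \<Longrightarrow> a \<noteq> g \<Longrightarrow> a \<noteq> f \<Longrightarrow> y a = 0) \<Longrightarrow> y f = \<kappa> * y g \<Longrightarrow> cob y (f \<union> g) = 0"
    using cancel_pair[of g f "f \<union> g"] fgh card_B[OF B(1)] by auto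
  obtain \<mu> :: 'k where \<mu>: "\<mu> \<noteq> 0"
    "\<And>y. (\<And>a. a \<subseteq> g \<union> h \<Longrightarrow> a \<noteq> g \<Longrightarrow> a \<noteq> h \<Longrightarrow> y a = 0) \<Longrightarrow> y h = \<mu> * y g \<Longrightarrow> cob y (g \<union> h) = 0"
    using cancel_pair[of g h "g \<union> h"] fgh card_B[OF B(2)] by auto
  show False
  proof (cases "x = x'")
    case True
    \<comment> \<open>The three members lie in one common facet, where the values at
      \<open>f\<close> and \<open>g\<close> already cancel; a facet of \<open>g\<close> avoiding
      \<open>x\<close> leaves their union.\<close>
    define r :: "'n set \<Rightarrow> 'k" where "r = (\<lambda>a. if a = g then 1 else if a = f then \<kappa> else 0)"
    obtain w where w: "w \<notin> g" "w \<noteq> x" "insert w g \<in> B" using other_facet[OF fgh(2) x(1)] .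
    have "r g = 0"
    proof (rule coefficient_vanishes[OF sub C' ex nopriv])
      show "cob r b = 0" if b: "b \<in> B" "a \<in> {f, g, h}" "a' \<in> {f, g, h}" "a \<noteq> a'" "a \<subseteq> b" "a' \<subseteq> b" for b a a'
      proof -
        have "b = a \<union> a'" using union_eq[of a a' b] b card_B sub by blast
        then have "b \<subseteq> f \<union> g" using b x x' True by auto
        then have "b = f \<union> g" using B_eq[OF card_B card_B] B b by blast
        then show ?thesis using \<kappa>(2)[of r] fgh by (auto simp: r_def)
      qed
      show "w \<notin> \<Union>{f, g, h}" using w x x' True by auto
    qed (use w fgh in \<open>auto simp: r_def\<close>)
    then show False by (simp add: r_def)
  next
    case False
    have notfg: "\<not> h \<subseteq> f \<union> g" using x x' False by auto
    have notgh: "\<not> f \<subseteq> g \<union> h" using x x' False by auto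
    have mem: "x \<in> f" "x' \<in> h" "x \<notin> h" "x' \<notin> f" using x x' False by auto
    define r :: "'n set \<Rightarrow> 'k" where
      "r = (\<lambda>a. if a = g then 1 else if a = f then \<kappa> else if a = h then \<mu> else 0)"
    have r0: "r a = 0" if "a \<notin> {f, g, h}" for a using that by (simp add: r_def)
    have rfg: "cob r (f \<union> g) = 0" using notfg fgh by (intro \<kappa>(2)) (auto simp: r_def)
    have rgh: "cob r (g \<union> h) = 0" using notgh fgh by (intro \<mu>(2)) (auto simp: r_def)
    \<comment> \<open>A third common facet imposes no new condition: \<open>cob r\<close> is zero on
      all other sets obtained from \<open>f \<union> g \<union> h\<close> by deleting an element,
      and \<open>cob_cob\<close> then makes it zero here.\<close>
    have rfh: "cob r (f \<union> h) = 0" if "f \<union> h \<in> B"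
    proof -
      have cfh: "card (f \<union> h) = Suc d" using card_B[OF that] .
      define e where "e = f \<union> g \<union> h"
      have e: "e = insert x' (f \<union> g)" "e = insert x (g \<union> h)" using x x' mem by (auto simp: e_def)
      have ce: "card e = Suc (Suc d)" unfolding e(1) using card_B[OF B(1)] mem x' by simp
      obtain p where p: "p \<notin> f" "f \<union> h = insert p f"
        using insert_of_subset[of f "f \<union> h", OF _ card_F[OF fgh(1)] cfh] by auto
      obtain q where q: "q \<notin> h" "f \<union> h = insert q h"
        using insert_of_subset[of h "f \<union> h", OF _ card_F[OF fgh(3)] cfh] by auto
      have pq: "p = x'" "q = x" using p q mem by auto
      obtain a where a: "a \<notin> f \<union> h" "e = insert a (f \<union> h)"
        using insert_of_subset[of "f \<union> h" e, OF _ cfh ce] by (auto simp: e_def)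
      have "cob (cob r) (insert a (f \<union> h)) = inc a (f \<union> h) * cob r (f \<union> h)"
      proof (rule cob_single[OF a(1)])
        fix j assume j: "j \<in> f \<union> h"
        consider "j = x" | "j = x'" | "j \<noteq> x" "j \<noteq> x'" by blast
        then show "cob r (insert a (f \<union> h) - {j}) = 0"
        proof cases
          case 1
          then have "e - {j} = g \<union> h" using e(2) x mem by auto
          then show ?thesis using rgh a by simp
        next
          case 2
          then have "e - {j} = f \<union> g" using e(1) x' mem by auto
          then show ?thesis using rfg a by simp
        next
          case 3
          then have "j \<in> f" "j \<in> h" using j p q pq by auto
          moreover have "j \<in> g" using 3 j x x' by auto
          ultimately have "j \<in> k" if "k \<in> {f, g, h}" for k using that by auto
          then show ?thesis by (intro cob_not_above[of "{f, g, h}" r, OF r0]) blast+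
        qed
      qed
      then show ?thesis by (simp add: cob_cob)
    qed
    have rinner: "cob r b = 0"
      if b: "b \<in> B" "a \<in> {f, g, h}" "a' \<in> {f, g, h}" "a \<noteq> a'" "a \<subseteq> b" "a' \<subseteq> b" for b a a'
    proof -
      have "b = a \<union> a'" using union_eq[of a a' b] b card_B sub by blast
      then have "b = f \<union> g \<or> b = g \<union> h \<or> b = f \<union> h" using b by auto
      then show ?thesis using rfg rgh rfh b by blast
    qed
    have outer: "w \<in> \<Union>{f, g, h}" if "insert w a \<in> B" "a \<in> {f, g, h}" for w a
    proof (rule ccontr)
      assume w: "w \<notin> \<Union>{f, g, h}"
      have "r a = 0"
        by (rule coefficient_vanishes[OF sub C' ex nopriv r0 rinner w that(2,1)])
      then show False using that \<kappa> \<mu> by (auto simp: r_def split: if_splits)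
    qed
    \<comment> \<open>This is \<open>r\<close> without its value at \<open>f\<close>. Since
      \<open>x\<close> lies in \<open>f\<close>, \<open>vanish\<close> at \<open>x\<close> ignores
      the facets of \<open>f\<close>. The facets of \<open>g\<close> and \<open>h\<close> lie in the
      union by \<open>outer\<close>, and among them only \<open>g \<union> h\<close> can avoid
      \<open>x\<close>.\<close>
    define \<alpha> :: "'n set \<Rightarrow> 'k" where "\<alpha> = (\<lambda>a. if a = g then 1 else if a = h then \<mu> else 0)"
    have \<alpha>0: "\<alpha> a = 0" if "a \<notin> {g, h}" for a using that by (simp add: \<alpha>_def)
    have \<alpha>gh: "cob \<alpha> (g \<union> h) = 0" using fgh by (intro \<mu>(2)) (auto simp: \<alpha>_def)
    have "\<alpha> g = 0"
    proof (rule vanish[of \<alpha> x g])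
      show "cob \<alpha> b = 0" if b: "b \<in> B" "x \<notin> b" for b
      proof -
        have cb: "card b = Suc d" using card_B[OF b(1)] .
        consider "g \<subseteq> b" | "h \<subseteq> b" | "\<not> g \<subseteq> b" "\<not> h \<subseteq> b" by blast
        then show ?thesis
        proof cases
          case 1
          obtain w where w: "w \<notin> g" "b = insert w g"
            using insert_of_subset[OF 1 card_F[OF fgh(2)] cb] .
          then have "w \<in> \<Union>{f, g, h}" using outer b by blast
          then have "w = x'" using w b x x' by auto
          then show ?thesis using w x' \<alpha>gh by simp
        next
          case 2
          obtain w where w: "w \<notin> h" "b = insert w h"
            using insert_of_subset[OF 2 card_F[OF fgh(3)] cb] .
          then have "w \<in> \<Union>{f, g, h}" using outer b by blast
          then have "w \<in> g" using w b x by auto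
          then have "b \<subseteq> g \<union> h" using w by auto
          then have "b = g \<union> h" using B_eq[OF cb card_B[OF B(2)]] by blast
          then show ?thesis using \<alpha>gh by simp
        next
          case 3
          then show ?thesis by (intro cob_not_above[of "{g, h}" \<alpha>, OF \<alpha>0]) auto
        qed
      qed
      show "\<alpha> a = 0" if "a \<notin> F" for a
        using that sub by (intro \<alpha>0) blast
    qed (use fgh x in simp_all)
    then show False by (simp add: \<alpha>_def)
  qed
qed

text \<open>Join two members that have a common facet. A graph on three vertices has an isolated
  vertex or a path through all of them; up to renaming these are the cases of
  \<open>exact_remove_isolated\<close> and \<open>private_path\<close>.\<close>

lemma private_three:
  assumes fgh: "f \<in> F" "g \<in> F" "h \<in> F" "f \<noteq> g" "f \<noteq> h" "g \<noteq> h" and C': "C' \<subseteq> C"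
    and ex: "exact {f, g, h} (above {f, g, h}) C'"
  shows "has_private {f, g, h} C'"
proof (cases "\<exists>f'\<in>{f, g, h}. \<forall>b\<in>B. \<forall>k\<in>{f, g, h}. f' \<subseteq> b \<and> k \<subseteq> b \<longrightarrow> k = f'")
  case True
  have *: "has_private {f, g, h} C'"
    if fgh: "f \<in> F" "g \<in> F" "h \<in> F" "f \<noteq> g" "f \<noteq> h" "g \<noteq> h"
      and ex: "exact {f, g, h} (above {f, g, h}) C'"
      and iso: "\<forall>b\<in>B. \<forall>k\<in>{f, g, h}. f \<subseteq> b \<and> k \<subseteq> b \<longrightarrow> k = f" for f g h
  proof (rule ccontr)
    assume npriv: "\<not> ?thesis"
    have "exact {g, h} (above {g, h}) {c\<in>C'. \<not> f \<subseteq> c}"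
    proof (rule exact_remove_isolated[OF fgh C' ex])
      show "g \<subseteq> c \<or> h \<subseteq> c" if "c \<in> C'" "f \<subseteq> c" for c
        using not_privateD[OF npriv that(1) _ that(2)] by auto
      show "\<not> g \<subseteq> b \<and> \<not> h \<subseteq> b" if "b \<in> B" "f \<subseteq> b" for b using iso that fgh by blast
    qed
    \<comment> \<open>The \<open>c\<close> found for \<open>g\<close> and \<open>h\<close> is not
      over \<open>f\<close>, so it is over only one of all three.\<close>
    then have "has_private {g, h} {c\<in>C'. \<not> f \<subseteq> c}"
      by (intro private_two) (use fgh C' in auto)
    then obtain a c where ac: "a \<in> {g, h}" "c \<in> C'" "\<not> f \<subseteq> c" "a \<subseteq> c"
      "\<forall>k\<in>{g, h}. k \<subseteq> c \<longrightarrow> k = a"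
      unfolding has_private_def by auto
    then show False using not_privateD[OF npriv ac(2) _ ac(4)] by auto
  qed
  from True consider "\<forall>b\<in>B. \<forall>k\<in>{f, g, h}. f \<subseteq> b \<and> k \<subseteq> b \<longrightarrow> k = f"
    | "\<forall>b\<in>B. \<forall>k\<in>{g, f, h}. g \<subseteq> b \<and> k \<subseteq> b \<longrightarrow> k = g"
    | "\<forall>b\<in>B. \<forall>k\<in>{h, f, g}. h \<subseteq> b \<and> k \<subseteq> b \<longrightarrow> k = h" by auto
  then show ?thesis
  proof cases
    case 1
    then show ?thesis by (rule *[OF fgh ex])
  next
    case 2
    have "{f, g, h} = {g, f, h}" by auto
    then show ?thesis using *[OF fgh(2,1,3) fgh(4)[symmetric] fgh(6,5) _ 2] ex by simp
  next
    case 3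
    have "{f, g, h} = {h, f, g}" by auto
    then show ?thesis
      using *[OF fgh(3,1,2) fgh(5)[symmetric] fgh(6)[symmetric] fgh(4) _ 3] ex by simp
  qed
next
  case False
  have pair: "k \<union> k' \<in> B" if "k \<in> F" "k' \<in> F" "k \<noteq> k'" "b \<in> B" "k \<subseteq> b" "k' \<subseteq> b" for k k' b
    using union_eq[OF that(1-3,5,6) card_B[OF that(4)]] that(4) by simp
  have near: "\<exists>k\<in>{f, g, h}. k \<noteq> f' \<and> f' \<union> k \<in> B" if f': "f' \<in> {f, g, h}" for f'
  proof -
    have "\<not> (\<forall>b\<in>B. \<forall>k\<in>{f, g, h}. f' \<subseteq> b \<and> k \<subseteq> b \<longrightarrow> k = f')"
    proof
      assume "\<forall>b\<in>B. \<forall>k\<in>{f, g, h}. f' \<subseteq> b \<and> k \<subseteq> b \<longrightarrow> k = f'"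
      then have "\<exists>f'\<in>{f, g, h}. \<forall>b\<in>B. \<forall>k\<in>{f, g, h}. f' \<subseteq> b \<and> k \<subseteq> b \<longrightarrow> k = f'"
        using f' by (rule bexI)
      with False show False by (rule notE)
    qed
    then obtain b k where "b \<in> B" "k \<in> {f, g, h}" "f' \<subseteq> b" "k \<subseteq> b" "k \<noteq> f'"
      by auto
    moreover have "f' \<in> F" "k \<in> F" using f' \<open>k \<in> {f, g, h}\<close> fgh by auto
    ultimately show ?thesis using pair[of f' k b] by blast
  qed
  have "f \<union> g \<in> B \<and> g \<union> h \<in> B \<or> g \<union> f \<in> B \<and> f \<union> h \<in> B \<or> f \<union> h \<in> B \<and> h \<union> g \<in> B"
    using near[of f] near[of g] near[of h] fgh by (auto simp: Un_commute)
  then consider "f \<union> g \<in> B" "g \<union> h \<in> B" | "g \<union> f \<in> B" "f \<union> h \<in> B" | "f \<union> h \<in> B" "h \<union> g \<in> B"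
    by blast
  then show ?thesis
  proof cases
    case 1
    then show ?thesis by (rule private_path[OF fgh C' ex])
  next
    case 2
    have "{f, g, h} = {g, f, h}" by auto
    then show ?thesis
      using private_path[OF fgh(2,1,3) fgh(4)[symmetric] fgh(6,5) C' _ 2] ex by simp
  next
    case 3
    have "{f, g, h} = {f, h, g}" by auto
    then show ?thesis
      using private_path[OF fgh(1,3,2) fgh(5,4) fgh(6)[symmetric] C' _ 3] ex by simp
  qed
qed

section \<open>Deletions that preserve exactness\<close>

lemma above_subset: "above F' \<subseteq> B"
  by (auto simp: above_def)

text \<open>
  If no \<open>c\<close> worked, then the unit vector at every \<open>c\<close> over \<open>b\<^sub>0\<close> would be hit from \<open>B' - {b\<^sub>0}\<close>, and
  \<open>b\<^sub>0\<close> could be completed to a cocycle that does not come from \<open>F'\<close>.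
\<close>

lemma exact_match:
  assumes ex: "exact F' B' C'" and b0: "b\<^sub>0 \<in> B'" "b\<^sub>0 \<in> B" "b\<^sub>0 \<notin> above F'"
  shows "\<exists>c\<in>C'. b\<^sub>0 \<subseteq> c \<and> exact F' (B' - {b\<^sub>0}) (C' - {c})"
proof (rule ccontr)
  assume contra: "\<not> ?thesis"
  define N where "N = {c\<in>C'. b\<^sub>0 \<subseteq> c}"
  have "\<exists>y :: 'n set \<Rightarrow> 'k. (\<forall>b. b \<notin> B' - {b\<^sub>0} \<longrightarrow> y b = 0) \<and> (\<forall>e\<in>C' - {c}. cob y e = 0) \<and> cob y c \<noteq> 0"
    if c: "c \<in> N" for c
  proof -
    have "\<not> exact F' (B' - {b\<^sub>0}) (C' - {c})" using c contra by (auto simp: N_def)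
    then obtain y :: "'n set \<Rightarrow> 'k" where y: "\<And>b. b \<notin> B' - {b\<^sub>0} \<Longrightarrow> y b = 0"
      "\<And>e. e \<in> C' - {c} \<Longrightarrow> cob y e = 0"
      "\<not> (\<exists>\<alpha>. (\<forall>f. f \<notin> F' \<longrightarrow> \<alpha> f = 0) \<and> (\<forall>b\<in>B. y b = cob \<alpha> b))"
      unfolding exact_def by blast
    \<comment> \<open>If \<open>y\<close> were closed at \<open>c\<close> too, it would be a
      coboundary by \<open>ex\<close>.\<close>
    have "cob y c \<noteq> 0"
    proof
      assume "cob y c = 0"
      then have *: "cob y e = 0" if "e \<in> C'" for e using y(2)[of e] that by (cases "e = c") auto
      have **: "y b = 0" if "b \<notin> B'" for b using y(1)[of b] that by blast
      obtain \<alpha> where "\<And>f. f \<notin> F' \<Longrightarrow> \<alpha> f = 0" "\<And>b. b \<in> B \<Longrightarrow> y b = cob \<alpha> b"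
        using exactD[OF ex ** *] by blast
      then show False using y(3) by blast
    qed
    then show ?thesis using y by (intro exI[of _ y]) blast
  qed
  then obtain Y :: "'n set \<Rightarrow> 'n set \<Rightarrow> 'k" where Y:
    "\<And>c b. c \<in> N \<Longrightarrow> b \<notin> B' - {b\<^sub>0} \<Longrightarrow> Y c b = 0"
    "\<And>c e. c \<in> N \<Longrightarrow> e \<in> C' - {c} \<Longrightarrow> cob (Y c) e = 0" "\<And>c. c \<in> N \<Longrightarrow> cob (Y c) c \<noteq> 0"
    by metis
  \<comment> \<open>Each \<open>Y c\<close> is nonzero at \<open>c\<close> and closed on the rest of
    \<open>C'\<close>, so these multiples cancel the coboundary of \<open>delta b\<^sub>0\<close> at
    one \<open>c\<close> at a time.\<close>
  define s where "s c = cob (delta b\<^sub>0) c / cob (Y c) c" for c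
  define z where "z = (\<lambda>b. delta b\<^sub>0 b - (\<Sum>c\<in>N. s c * Y c b))"
  have supp: "z b = 0" if "b \<notin> B'" for b
    using that b0 Y(1) by (auto simp: z_def delta_def)
  have coc: "cob z e = 0" if e: "e \<in> C'" for e
  proof (cases "e \<in> N")
    case True
    have "(\<Sum>c\<in>N. s c * cob (Y c) e) = (\<Sum>c\<in>{e}. s c * cob (Y c) e)"
      by (rule sum.mono_neutral_right) (use True Y(2) e in auto)
    then show ?thesis
      unfolding z_def cob_diff cob_sum cob_scale using Y(3)[OF True] by (simp add: s_def)
  next
    case False
    then have "cob (delta b\<^sub>0) e = 0" using e by (intro cob_delta_zero) (auto simp: N_def)
    moreover have "(\<Sum>c\<in>N. s c * cob (Y c) e) = 0"
    proof (rule sum.neutral, rule ballI)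
      fix c assume "c \<in> N"
      moreover from this have "e \<in> C' - {c}" using False e by blast
      ultimately show "s c * cob (Y c) e = 0" using Y(2) by simp
    qed
    ultimately show ?thesis unfolding z_def cob_diff cob_sum cob_scale by simp
  qed
  obtain \<alpha> where \<alpha>: "\<And>f. f \<notin> F' \<Longrightarrow> \<alpha> f = 0" "\<And>b. b \<in> B \<Longrightarrow> z b = cob \<alpha> b"
    using exactD[OF ex supp coc] by blast
  \<comment> \<open>Every \<open>Y c\<close> avoids \<open>b\<^sub>0\<close>, while a coboundary
    from \<open>F'\<close> is zero there because \<open>b\<^sub>0\<close> is not above
    \<open>F'\<close>.\<close>
  have "z b\<^sub>0 = 1" using Y(1) by (simp add: z_def delta_def)
  moreover have "cob \<alpha> b\<^sub>0 = 0"
    by (rule cob_not_above[of F' \<alpha>, OF \<alpha>(1)]) (use b0 in \<open>auto simp: above_def\<close>)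
  ultimately show False using \<alpha>(2)[OF b0(2)] by simp
qed

text \<open>A cochain that vanishes on the interval \<open>[f, c]\<close> vanishes by
  \<open>facets\<close> on everything below \<open>c\<close>, so it is closed at \<open>c\<close>
  for free. A facet of \<open>f\<close> inside \<open>c\<close> is over no other member of
  \<open>F'\<close> and shows that \<open>\<alpha> f\<close> is zero.\<close>

lemma exact_remove:
  assumes sub: "F' \<subseteq> F" "C' \<subseteq> C" and ex: "exact F' B' C'" and above: "above F' \<subseteq> B'"
    and f: "f \<in> F'" and c: "c \<in> C'" "f \<subseteq> c" and only: "\<And>g. g \<in> F' \<Longrightarrow> g \<subseteq> c \<Longrightarrow> g = f"
    and facets: "\<And>b. b \<in> B' \<Longrightarrow> b \<subseteq> c \<Longrightarrow> f \<subseteq> b"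
  shows "exact (F' - {f}) (B' - {b. f \<subseteq> b \<and> b \<subseteq> c}) (C' - {c})"
    and "above (F' - {f}) \<subseteq> B' - {b. f \<subseteq> b \<and> b \<subseteq> c}"
proof -
  have fF: "f \<in> F" and cC: "c \<in> C" using sub f c by auto
  show "above (F' - {f}) \<subseteq> B' - {b. f \<subseteq> b \<and> b \<subseteq> c}"
  proof
    fix b assume "b \<in> above (F' - {f})"
    then obtain g where g: "b \<in> B" "g \<in> F'" "g \<noteq> f" "g \<subseteq> b" by (auto simp: above_def)
    then have "b \<in> above F'" by (auto simp: above_def)
    moreover have "\<not> b \<subseteq> c" using only[of g] g by blast
    ultimately show "b \<in> B' - {b. f \<subseteq> b \<and> b \<subseteq> c}" using above by blast
  qed
  show "exact (F' - {f}) (B' - {b. f \<subseteq> b \<and> b \<subseteq> c}) (C' - {c})"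
    unfolding exact_def
  proof (intro allI impI)
    fix y :: "'n set \<Rightarrow> 'k"
    assume y: "\<forall>b. b \<notin> B' - {b. f \<subseteq> b \<and> b \<subseteq> c} \<longrightarrow> y b = 0" "\<forall>e\<in>C' - {c}. cob y e = 0"
    have "y (c - {j}) = 0" for j using y(1) facets[of "c - {j}"] by blast
    then have "cob y c = 0" by (intro cob_zero)
    then have coc: "cob y e = 0" if "e \<in> C'" for e using y(2) that by (cases "e = c") auto
    have supp: "y b = 0" if "b \<notin> B'" for b using y(1) that by blast
    obtain \<alpha> where \<alpha>: "\<And>f. f \<notin> F' \<Longrightarrow> \<alpha> f = 0" "\<And>b. b \<in> B \<Longrightarrow> y b = cob \<alpha> b"
      using exactD[OF ex supp coc] by blast
    have "\<not> c \<subseteq> f" using card_mono[of f c] card_F[OF fF] card_C[OF cC] by auto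
    then obtain w where w: "w \<in> c" "w \<notin> f" by blast
    have wB: "insert w f \<in> B"
      by (rule convex[OF fF cC]) (use w c card_F[OF fF] in auto)
    have "inc w f * \<alpha> f = cob \<alpha> (insert w f)"
    proof (rule cob_unique[of F' \<alpha>, OF \<alpha>(1), symmetric])
      fix g assume g: "g \<in> F'" "g \<subseteq> insert w f"
      moreover have "insert w f \<subseteq> c" using w c by blast
      ultimately show "g = f" by (intro only) auto
    qed (use w in auto)
    also have "\<dots> = y (insert w f)" using \<alpha>(2)[OF wB] by simp
    also have "\<dots> = 0" using y(1) w c by blast
    finally have "\<alpha> f = 0" by simp
    then have "\<forall>g. g \<notin> F' - {f} \<longrightarrow> \<alpha> g = 0" using \<alpha>(1) by blast
    then show "\<exists>\<alpha>. (\<forall>g. g \<notin> F' - {f} \<longrightarrow> \<alpha> g = 0) \<and> (\<forall>b\<in>B. y b = cob \<alpha> b)"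
      using \<alpha>(2) by blast
  qed
qed

section \<open>Assembling the tops of the intervals\<close>

definition rest :: "'n set set \<Rightarrow> 'n set set \<Rightarrow> ('n set \<Rightarrow> 'n set) \<Rightarrow> 'n set set" where
  "rest F' B' p = {b\<in>B'. \<forall>f\<in>F'. \<not> (f \<subseteq> b \<and> b \<subseteq> p f)}"

text \<open>
  The tops \<open>p f\<close> and \<open>m b\<close> of pairwise disjoint intervals \<open>[f, p f]\<close> and \<open>[b, m b]\<close>, where \<open>b\<close>
  runs through the members of \<open>B'\<close> outside the intervals \<open>[f, p f]\<close>.
\<close>

definition tops :: "'n set set \<Rightarrow> 'n set set \<Rightarrow> 'n set set \<Rightarrow>
    ('n set \<Rightarrow> 'n set) \<Rightarrow> ('n set \<Rightarrow> 'n set) \<Rightarrow> bool" where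
  "tops F' B' C' p m \<longleftrightarrow>
     (\<forall>f\<in>F'. p f \<in> C' \<and> f \<subseteq> p f) \<and> inj_on p F' \<and>
     (\<forall>f\<in>F'. \<forall>g\<in>F'. \<forall>b\<in>B. f \<subseteq> b \<and> b \<subseteq> p f \<and> g \<subseteq> b \<and> b \<subseteq> p g \<longrightarrow> f = g) \<and>
     (\<forall>b\<in>rest F' B' p. m b \<in> C' \<and> b \<subseteq> m b) \<and> inj_on m (rest F' B' p) \<and>
     m ` rest F' B' p \<inter> p ` F' = {}"

lemma tops_match:
  assumes t: "tops F' (B' - {b\<^sub>0}) (C' - {c}) p m"
    and b0: "b\<^sub>0 \<in> B'" "b\<^sub>0 \<in> B" "b\<^sub>0 \<notin> above F'" and c: "c \<in> C'" "b\<^sub>0 \<subseteq> c"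
  shows "tops F' B' C' p (m(b\<^sub>0 := c))"
proof -
  define R where "R = rest F' (B' - {b\<^sub>0}) p"
  have R: "rest F' B' p = insert b\<^sub>0 R" and nR: "b\<^sub>0 \<notin> R"
    using b0 by (auto simp: R_def rest_def above_def)
  have t': "\<forall>f\<in>F'. p f \<in> C' - {c} \<and> f \<subseteq> p f" "inj_on p F'"
    "\<forall>f\<in>F'. \<forall>g\<in>F'. \<forall>b\<in>B. f \<subseteq> b \<and> b \<subseteq> p f \<and> g \<subseteq> b \<and> b \<subseteq> p g \<longrightarrow> f = g"
    "\<forall>b\<in>R. m b \<in> C' - {c} \<and> b \<subseteq> m b" "inj_on m R" "m ` R \<inter> p ` F' = {}"
    using t by (simp_all add: tops_def R_def)
  have mR: "(m(b\<^sub>0 := c)) ` R = m ` R" using nR by (intro image_cong) auto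
  have "inj_on (m(b\<^sub>0 := c)) (insert b\<^sub>0 R)"
    using t'(4,5) nR mR by (auto simp: inj_on_def)
  moreover have "(m(b\<^sub>0 := c)) ` insert b\<^sub>0 R \<inter> p ` F' = {}"
    using t'(1,6) mR by auto
  moreover have "\<forall>b\<in>insert b\<^sub>0 R. (m(b\<^sub>0 := c)) b \<in> C' \<and> b \<subseteq> (m(b\<^sub>0 := c)) b"
    using t'(4) c by auto
  moreover have "\<forall>f\<in>F'. p f \<in> C' \<and> f \<subseteq> p f" using t'(1) by blast
  ultimately show ?thesis unfolding tops_def R using t'(2,3) by blast
qed

text \<open>An interval over another \<open>g\<close> that met \<open>[f, c]\<close> would put
  \<open>g\<close> below \<open>c\<close>, against \<open>only\<close>.\<close>

lemma tops_remove:
  assumes t: "tops (F' - {f}) (B' - {b. f \<subseteq> b \<and> b \<subseteq> c}) (C' - {c}) p m"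
    and f: "f \<in> F'" and c: "c \<in> C'" "f \<subseteq> c" and only: "\<And>g. g \<in> F' \<Longrightarrow> g \<subseteq> c \<Longrightarrow> g = f"
  shows "tops F' B' C' (p(f := c)) m"
proof -
  define R where "R = rest (F' - {f}) (B' - {b. f \<subseteq> b \<and> b \<subseteq> c}) p"
  have R: "rest F' B' (p(f := c)) = R"
    using f unfolding R_def rest_def by (auto split: if_splits)
  have t': "\<forall>g\<in>F' - {f}. p g \<in> C' - {c} \<and> g \<subseteq> p g" "inj_on p (F' - {f})"
    "\<forall>g\<in>F' - {f}. \<forall>h\<in>F' - {f}. \<forall>b\<in>B. g \<subseteq> b \<and> b \<subseteq> p g \<and> h \<subseteq> b \<and> b \<subseteq> p h \<longrightarrow> g = h"
    "\<forall>b\<in>R. m b \<in> C' - {c} \<and> b \<subseteq> m b" "inj_on m R" "m ` R \<inter> p ` (F' - {f}) = {}"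
    using t by (simp_all add: tops_def R_def)
  have F': "F' = insert f (F' - {f})" using f by blast
  have img: "(p(f := c)) ` F' = insert c (p ` (F' - {f}))" by (subst F') auto
  have inj: "inj_on (p(f := c)) F'"
    using t'(1,2) by (auto simp: inj_on_def)
  have img_disj: "m ` R \<inter> (p(f := c)) ` F' = {}"
    unfolding img using t'(4,6) by auto
  have tops: "\<forall>g\<in>F'. (p(f := c)) g \<in> C' \<and> g \<subseteq> (p(f := c)) g" using t'(1) c by auto
  have disj: "g = h" if "g \<in> F'" "h \<in> F'" "b \<in> B" "g \<subseteq> b" "b \<subseteq> (p(f := c)) g" "h \<subseteq> b" "b \<subseteq> (p(f := c)) h"
    for g h b
  proof (cases "g = f \<or> h = f")
    case True
    then have "b \<subseteq> c" using that by auto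
    then have "g \<subseteq> c" "h \<subseteq> c" using that by blast+
    then show ?thesis using only[OF that(1)] only[OF that(2)] by simp
  next
    case False
    then show ?thesis using t'(3) that by auto
  qed
  have "\<forall>b\<in>R. m b \<in> C' \<and> b \<subseteq> m b" using t'(4) by blast
  moreover have "\<forall>g\<in>F'. \<forall>h\<in>F'. \<forall>b\<in>B.
      g \<subseteq> b \<and> b \<subseteq> (p(f := c)) g \<and> h \<subseteq> b \<and> b \<subseteq> (p(f := c)) h \<longrightarrow> g = h"
    by (intro ballI impI, elim conjE, rule disj)
  ultimately show ?thesis unfolding tops_def R using inj img_disj tops t'(5) by (intro conjI)
qed

text \<open>Members of \<open>B'\<close> not above \<open>F'\<close> are matched first. Once
  \<open>B'\<close> is \<open>above F'\<close>, the lemmas on \<open>has_private\<close> apply, and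
  a member of \<open>B'\<close> below the private \<open>c\<close> contains its \<open>f\<close>, as
  \<open>exact_remove\<close> requires. Facets of \<open>f\<close> outside \<open>[f, c]\<close> may
  then no longer be above the rest of \<open>F'\<close>; they are matched in turn.\<close>

lemma tops_exist:
  assumes "F' \<subseteq> F" "card F' \<le> 3" "B' \<subseteq> B" "C' \<subseteq> C" "above F' \<subseteq> B'" "exact F' B' C'"
  shows "\<exists>p m. tops F' B' C' p m"
  using assms
proof (induction "card F' + card B'" arbitrary: F' B' C' rule: less_induct)
  case less
  show ?case
  proof (cases "B' \<subseteq> above F'")
    case False
    then obtain b where b: "b \<in> B'" "b \<notin> above F'" by blast
    then have bB: "b \<in> B" using less.prems by blast
    obtain c where c: "c \<in> C'" "b \<subseteq> c" "exact F' (B' - {b}) (C' - {c})"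
      using exact_match[OF less.prems(6) b(1) bB b(2)] by blast
    have "card (B' - {b}) < card B'" using b by (intro psubset_card_mono) auto
    then have "\<exists>p m. tops F' (B' - {b}) (C' - {c}) p m"
      using less.prems b c by (intro less.hyps) auto
    then show ?thesis using tops_match[OF _ b(1) bB b(2) c(1,2)] by blast
  next
    case True
    then have B': "B' = above F'" using less.prems by blast
    show ?thesis
    proof (cases "F' = {}")
      case True
      then have "B' = {}" using B' by (simp add: above_def)
      then have "tops F' B' C' id id" using True by (simp add: tops_def rest_def)
      then show ?thesis by blast
    next
      case False
      have "card F' = 1 \<or> card F' = 2 \<or> card F' = 3"
        using False less.prems(2) by (cases "card F'") (auto simp: le_Suc_eq)
      then have "has_private F' C'"
      proof (elim disjE)
        assume "card F' = 1"
        then obtain f where "F' = {f}" by (auto simp: card_1_singleton_iff)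
        then show ?thesis using private_one less.prems B' by simp
      next
        assume "card F' = 2"
        then obtain f g where "F' = {f, g}" "f \<noteq> g" by (auto simp: card_2_iff)
        then show ?thesis using private_two[of f g] less.prems B' by simp
      next
        assume "card F' = 3"
        then obtain f g h where "F' = {f, g, h}" "f \<noteq> g" "f \<noteq> h" "g \<noteq> h" by (auto simp: card_3_iff)
        then show ?thesis using private_three[of f g h] less.prems B' by simp
      qed
      then obtain f c where fc: "f \<in> F'" "c \<in> C'" "f \<subseteq> c" "\<And>g. g \<in> F' \<Longrightarrow> g \<subseteq> c \<Longrightarrow> g = f"
        unfolding has_private_def by metis
      have facets: "f \<subseteq> b" if "b \<in> B'" "b \<subseteq> c" for b
      proof -
        obtain g where "g \<in> F'" "g \<subseteq> b" using \<open>b \<in> B'\<close> B' by (auto simp: above_def)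
        then show ?thesis using fc(4)[of g] that by auto
      qed
      note rem = exact_remove[OF less.prems(1,4,6,5) fc facets]
      have "card (F' - {f}) < card F'" using fc(1) by (intro psubset_card_mono) auto
      moreover have "card (B' - {b. f \<subseteq> b \<and> b \<subseteq> c}) \<le> card B'" by (intro card_mono) auto
      ultimately have "\<exists>p m. tops (F' - {f}) (B' - {b. f \<subseteq> b \<and> b \<subseteq> c}) (C' - {c}) p m"
        using less.prems rem by (intro less.hyps) auto
      then show ?thesis using tops_remove[OF _ fc] by blast
    qed
  qed
qed

end

subsection \<open>Regular sequences and the Koszul complex\<close>

lemma kos_diff: "kos x (\<lambda>b. y b - z b) c = kos x y c - kos x z c"
  by (simp add: kos_def right_diff_distrib sum_subtractf)

lemma kos_scale: "kos x (\<lambda>b. a * y b) c = a * kos x y c"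
  by (simp add: kos_def sum_distrib_left mult_ac)

lemma kos_sum: "kos x (\<lambda>b. \<Sum>i\<in>X. y i b) c = (\<Sum>i\<in>X. kos x (y i) c)"
  unfolding kos_def sum_distrib_left by (rule sum.swap)

lemma kos_in_ideal:
  assumes "ideal.subspace N" "\<And>b. y b \<in> N"
  shows "kos x y c \<in> N"
  unfolding kos_def using assms by (intro ideal.subspace_sum ideal.subspace_scale) auto

text \<open>In the indexing by complements this is, up to sign, exterior multiplication by the basis
  vector of \<open>j\<close>.\<close>

definition contract :: "'n::finite \<Rightarrow> ('n set \<Rightarrow> 'a::comm_ring_1) \<Rightarrow> 'n set \<Rightarrow> 'a" where
  "contract j y b = (if j \<in> b then 0 else inc j b * y (insert j b))"

text \<open>If \<open>j\<close> is in \<open>b\<close>, only the summand that removes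
  \<open>j\<close> survives. Otherwise all summands but one cancel by
  \<open>inc_swap\<close>.\<close>

lemma kos_contract:
  fixes y :: "'n::finite set \<Rightarrow> 'a::comm_ring_1"
  shows "kos x (contract j y) b + contract j (kos x y) b = x j * y b"
proof (cases "j \<in> b")
  case True
  have "kos x (contract j y) b = (\<Sum>i\<in>{j}. inc i b * x i * contract j y (b - {i}))"
    unfolding kos_def by (rule sum.mono_neutral_right) (use True in \<open>auto simp: contract_def\<close>)
  moreover have "inc j (b - {j}) = (inc j b :: 'a)"
    by (subst inc_self[symmetric]) (use True in \<open>simp add: insert_absorb\<close>)
  then have "(\<Sum>i\<in>{j}. inc i b * x i * contract j y (b - {i})) = (inc j b * inc j b) * (x j * y b)"
    using True by (simp add: contract_def insert_absorb mult_ac)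
  ultimately show ?thesis using True by (simp add: inc_square contract_def)
next
  case False
  define c where "c = insert j b"
  have "contract j (kos x y) b = inc j b * (inc j c * x j * y b + (\<Sum>i\<in>b. inc i c * x i * y (c - {i})))"
    using False by (simp add: contract_def kos_def c_def)
  also have "inc j c = inc j b" by (simp add: c_def inc_self)
  finally have "contract j (kos x y) b
      = (inc j b * inc j b) * (x j * y b) + (\<Sum>i\<in>b. inc j b * inc i c * (x i * y (c - {i})))"
    by (simp add: sum_distrib_left algebra_simps)
  moreover have "kos x (contract j y) b = (\<Sum>i\<in>b. - (inc j b * inc i c * (x i * y (c - {i}))))"
    unfolding kos_def
  proof (rule sum.cong)
    fix i assume i: "i \<in> b"
    then have "i \<noteq> j" using False by auto
    then have ci: "c - {i} = insert j (b - {i})" and cj: "c - {j} = b" using False by (auto simp: c_def)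
    have "inc i c * inc j (c - {i}) = - (inc j c * inc i (c - {j}) :: 'a)"
      by (rule inc_swap) (use i \<open>i \<noteq> j\<close> in \<open>auto simp: c_def\<close>)
    then have "inc i c * inc j (b - {i}) = - (inc j b * inc i b :: 'a)"
      unfolding ci cj by (simp add: inc_self c_def)
    \<comment> \<open>Signs are moved across the equation by multiplying with them, since they
      square to 1; the ring has no division.\<close>
    then have "inc i c * (inc i c * inc j (b - {i})) * inc i b = inc i c * - (inc j b * inc i b :: 'a) * inc i b"
      by simp
    then have "(inc i c * inc i c) * (inc i b * inc j (b - {i})) = - (inc j b * inc i c * (inc i b * inc i b) :: 'a)"
      by (simp add: mult_ac)
    then have "inc i b * inc j (b - {i}) = - (inc j b * inc i c :: 'a)"
      by (simp add: inc_square)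
    then have "inc i b * inc j (b - {i}) * (x i * y (c - {i})) = - (inc j b * inc i c * (x i * y (c - {i})))"
      by simp
    then show "inc i b * x i * contract j y (b - {i}) = - (inc j b * inc i c * (x i * y (c - {i})))"
      using False ci by (simp add: contract_def mult_ac)
  qed simp
  ultimately show ?thesis by (simp add: inc_square sum_negf)
qed

lemma span_range_eq:
  fixes x :: "'n::finite \<Rightarrow> 'a::comm_ring_1"
  assumes "g \<in> ideal.span (range x)"
  obtains a where "g = (\<Sum>j\<in>UNIV. a j * x j)"
proof -
  have "ideal.span (range x) \<subseteq> range (\<lambda>a. \<Sum>j\<in>UNIV. a j * x j)"
  proof (rule ideal.span_minimal)
    show "range x \<subseteq> range (\<lambda>a. \<Sum>j\<in>UNIV. a j * x j)"
    proof
      fix y assume "y \<in> range x"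
      then obtain i where "y = x i" by blast
      then have "y = (\<Sum>j\<in>UNIV. (if j = i then 1 else 0) * x j)"
        by (simp add: if_distrib[of "\<lambda>a. a * _"] cong: if_cong)
      then show "y \<in> range (\<lambda>a. \<Sum>j\<in>UNIV. a j * x j)"
        by (rule range_eqI[of _ _ "\<lambda>j. if j = i then 1 else 0"])
    qed
    show "ideal.subspace (range (\<lambda>a. \<Sum>j\<in>UNIV. a j * x j))"
      unfolding ideal.subspace_def
    proof (intro conjI ballI allI)
      show "0 \<in> range (\<lambda>a. \<Sum>j\<in>UNIV. a j * x j)" by (rule range_eqI[of _ _ "\<lambda>_. 0"]) simp
      show "y + z \<in> range (\<lambda>a. \<Sum>j\<in>UNIV. a j * x j)"
        if yz: "y \<in> range (\<lambda>a. \<Sum>j\<in>UNIV. a j * x j)" "z \<in> range (\<lambda>a. \<Sum>j\<in>UNIV. a j * x j)" for y z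
      proof -
        obtain a b where "y = (\<Sum>j\<in>UNIV. a j * x j)" "z = (\<Sum>j\<in>UNIV. b j * x j)" using yz by blast
        then show ?thesis
          by (intro range_eqI[of _ _ "\<lambda>j. a j + b j"]) (simp add: distrib_right sum.distrib)
      qed
      show "c * y \<in> range (\<lambda>a. \<Sum>j\<in>UNIV. a j * x j)"
        if y: "y \<in> range (\<lambda>a. \<Sum>j\<in>UNIV. a j * x j)" for c y
      proof -
        obtain a where "y = (\<Sum>j\<in>UNIV. a j * x j)" using y by blast
        then show ?thesis
          by (intro range_eqI[of _ _ "\<lambda>j. c * a j"]) (simp add: sum_distrib_left mult.assoc)
      qed
    qed
  qed
  then show ?thesis using assms that by blast
qed

lemma mult_preimage_subspace: "ideal.subspace (mult_preimage I J A)"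
  unfolding mult_preimage_def by (rule ideal.subspace_span)

lemma mult_preimage_mono: "A \<subseteq> A' \<Longrightarrow> mult_preimage I J A \<subseteq> mult_preimage I J A'"
  unfolding mult_preimage_def by (rule ideal.span_mono) blast

lemma mult_preimage_mult: "a \<in> A \<Longrightarrow> f \<in> I \<Longrightarrow> a * f \<in> mult_preimage I J A"
  unfolding mult_preimage_def by (rule ideal.span_base) blast

lemma mult_preimage_insert:
  assumes I: "ideal.subspace I" and f: "f \<in> mult_preimage I J (insert g A)"
  obtains h where "h \<in> I" "f - g * h \<in> mult_preimage I J A"
proof -
  let ?N = "mult_preimage I J A"
  let ?M = "{f. \<exists>h\<in>I. f - g * h \<in> ?N}"
  have N: "ideal.subspace ?N" by (rule mult_preimage_subspace)
  have "mult_preimage I J (insert g A) \<subseteq> ?M"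
    unfolding mult_preimage_def[of I J "insert g A"]
  proof (rule ideal.span_minimal)
    show "{a * f |a f. a \<in> insert g A \<and> f \<in> I} \<union> J \<subseteq> ?M"
    proof
      fix y assume "y \<in> {a * f |a f. a \<in> insert g A \<and> f \<in> I} \<union> J"
      then consider f where "f \<in> I" "y = g * f" | a f where "a \<in> A" "f \<in> I" "y = a * f" | "y \<in> J"
        by blast
      then show "y \<in> ?M"
      proof cases
        case 1
        then have "y - g * f \<in> ?N" using ideal.subspace_0[OF N] by simp
        then show ?thesis using 1(1) by blast
      next
        case 2
        then have "y - g * 0 \<in> ?N" using mult_preimage_mult by simp
        then show ?thesis using ideal.subspace_0[OF I] by blast
      next
        case 3
        then have "y - g * 0 \<in> ?N" unfolding mult_preimage_def by (simp add: ideal.span_base)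
        then show ?thesis using ideal.subspace_0[OF I] by blast
      qed
    qed
    show "ideal.subspace ?M"
      unfolding ideal.subspace_def
    proof (intro conjI ballI allI)
      have "0 - g * 0 \<in> ?N" using ideal.subspace_0[OF N] by simp
      then show "0 \<in> ?M" using ideal.subspace_0[OF I] by blast
      show "y + z \<in> ?M" if yz: "y \<in> ?M" "z \<in> ?M" for y z
      proof -
        obtain h k where hk: "h \<in> I" "y - g * h \<in> ?N" "k \<in> I" "z - g * k \<in> ?N" using yz by blast
        have "(y - g * h) + (z - g * k) \<in> ?N" using hk by (intro ideal.subspace_add[OF N])
        then have "y + z - g * (h + k) \<in> ?N" by (simp add: algebra_simps)
        then show ?thesis using ideal.subspace_add[OF I hk(1,3)] by blast
      qed
      show "c * y \<in> ?M" if y: "y \<in> ?M" for c y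
      proof -
        obtain h where h: "h \<in> I" "y - g * h \<in> ?N" using y by blast
        have "c * (y - g * h) \<in> ?N" using h by (intro ideal.subspace_scale[OF N])
        then have "c * y - g * (c * h) \<in> ?N" by (simp add: algebra_simps)
        then show ?thesis using ideal.subspace_scale[OF I h(1)] by blast
      qed
    qed
  qed
  then show ?thesis using f that by blast
qed

text \<open>
  Multiplication by an element of \<open>(x)\<close> is null-homotopic on the Koszul complex. Hence if \<open>g\<close> is
  regular on \<open>M\<close>, vanishing of the Koszul homology of \<open>M/gM\<close> in one degree gives that of \<open>M\<close> in
  the adjacent one.
\<close>

lemma koszul_step:
  fixes x :: "'n::finite \<Rightarrow> 'a::comm_ring_1"
  assumes I: "ideal.subspace I" and N: "ideal.subspace N" "N \<subseteq> N'"
    and N': "\<And>f. f \<in> N' \<Longrightarrow> \<exists>h\<in>I. f - g * h \<in> N" "\<And>h. h \<in> I \<Longrightarrow> g * h \<in> N'" "ideal.subspace N'"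
    and regular: "\<And>f. f \<in> I \<Longrightarrow> g * f \<in> N \<Longrightarrow> f \<in> N"
    and g: "g \<in> ideal.span (range x)"
    and IH: "\<And>y. (\<And>b. y b \<in> I) \<Longrightarrow> (\<And>b. m \<le> card b \<Longrightarrow> y b = 0) \<Longrightarrow> (\<And>b. kos x y b \<in> N') \<Longrightarrow>
      \<exists>z. (\<forall>b. z b \<in> I) \<and> (\<forall>b. y b - kos x z b \<in> N')"
    and y: "\<And>b. y b \<in> I" "\<And>b. Suc m \<le> card b \<Longrightarrow> y b = 0" "\<And>b. kos x y b \<in> N"
  shows "\<exists>z. (\<forall>b. z b \<in> I) \<and> (\<forall>b. y b - kos x z b \<in> N)"
proof -
  obtain a where a: "g = (\<Sum>j\<in>UNIV. a j * x j)" using span_range_eq[OF g] .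
  \<comment> \<open>The homotopy applied to \<open>y\<close>: the differential of \<open>w\<close>
    is \<open>g * y\<close> up to the error \<open>e\<close> in \<open>N\<close>, and the components
    of \<open>w\<close> vanish one size earlier than those of \<open>y\<close>.\<close>
  define w where "w = (\<lambda>b. \<Sum>j\<in>UNIV. a j * contract j y b)"
  define e where "e = (\<lambda>b. \<Sum>j\<in>UNIV. a j * contract j (kos x y) b)"
  have contr: "contract j z b \<in> L" if "ideal.subspace L" "\<And>b. z b \<in> L" for L j z and b :: "'n set"
    using that by (auto simp: contract_def intro: ideal.subspace_0 ideal.subspace_scale)
  have eN: "e b \<in> N" for b
    unfolding e_def using N(1) y(3) by (intro ideal.subspace_sum ideal.subspace_scale contr)
  have kw: "kos x w b = g * y b - e b" for b
  proof -
    have "kos x w b + e b = (\<Sum>j\<in>UNIV. a j * (kos x (contract j y) b + contract j (kos x y) b))"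
      unfolding w_def e_def kos_sum kos_scale by (simp add: distrib_left sum.distrib)
    also have "\<dots> = (\<Sum>j\<in>UNIV. a j * (x j * y b))" by (simp only: kos_contract)
    also have "\<dots> = g * y b" by (simp add: a sum_distrib_right mult.assoc)
    finally show ?thesis by (simp add: eq_diff_eq)
  qed
  have "\<exists>z. (\<forall>b. z b \<in> I) \<and> (\<forall>b. w b - kos x z b \<in> N')"
  proof (rule IH)
    show "w b \<in> I" for b
      unfolding w_def using I y(1) by (intro ideal.subspace_sum ideal.subspace_scale contr)
    show "w b = 0" if "m \<le> card b" for b
      unfolding w_def
    proof (rule sum.neutral, rule ballI)
      fix j
      show "a j * contract j y b = 0"
        using that y(2)[of "insert j b"] by (simp add: contract_def)
    qed
    show "kos x w b \<in> N'" for b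
      unfolding kw using N'(2)[OF y(1)] eN N(2) by (intro ideal.subspace_diff[OF N'(3)]) auto
  qed
  then obtain z where z: "\<And>b. z b \<in> I" "\<And>b. w b - kos x z b \<in> N'" by blast
  have "\<forall>b. \<exists>h. h \<in> I \<and> (w b - kos x z b) - g * h \<in> N" using N'(1)[OF z(2)] by blast
  then obtain u where u: "\<And>b. u b \<in> I" "\<And>b. (w b - kos x z b) - g * u b \<in> N" by metis
  have "y b - kos x u b \<in> N" for b
  proof (rule regular)
    show "y b - kos x u b \<in> I"
      using kos_in_ideal[OF I u(1)] y(1) by (intro ideal.subspace_diff[OF I])
    \<comment> \<open>Modulo \<open>N\<close>, \<open>w\<close> is \<open>kos x z + g * u\<close>.
      Applying the differential removes \<open>z\<close> by \<open>kos_kos\<close> and leaves a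
      multiple of \<open>g\<close> that \<open>regular\<close> can cancel.\<close>
    have "kos x (\<lambda>b. (w b - kos x z b) - g * u b) b = kos x w b - g * kos x u b"
      unfolding kos_diff kos_scale kos_kos by simp
    then have "g * (y b - kos x u b) = e b + kos x (\<lambda>b. (w b - kos x z b) - g * u b) b"
      unfolding kw by (simp add: algebra_simps)
    also have "\<dots> \<in> N" using eN kos_in_ideal[OF N(1) u(2)] by (intro ideal.subspace_add[OF N(1)])
    finally show "g * (y b - kos x u b) \<in> N" .
  qed
  then show ?thesis using u(1) by blast
qed

lemma koszul_regular:
  fixes x :: "'n::finite \<Rightarrow> 'a::comm_ring_1"
  assumes I: "ideal.subspace I" and reg: "regular_sequence I J gs"
    and gs: "set gs \<subseteq> ideal.span (range x)" and "k \<le> length gs"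
    and "\<And>b. y b \<in> I" "\<And>b. k \<le> card b \<Longrightarrow> y b = 0"
    and "\<And>b. kos x y b \<in> mult_preimage I J (set (take (length gs - k) gs))"
  shows "\<exists>z. (\<forall>b. z b \<in> I) \<and> (\<forall>b. y b - kos x z b \<in> mult_preimage I J (set (take (length gs - k) gs)))"
  using assms(4-7)
proof (induction k arbitrary: y)
  case 0
  then have "y b - kos x (\<lambda>_. 0) b = 0" for b by (simp add: kos_def)
  then show ?case
    using ideal.subspace_0[OF I] ideal.subspace_0[OF mult_preimage_subspace]
    by (intro exI[of _ "\<lambda>_. 0"]) simp
next
  case (Suc k)
  define i where "i = length gs - Suc k"
  have i: "i < length gs" "length gs - k = Suc i" using Suc.prems(1) by (auto simp: i_def)
  have take: "set (take (Suc i) gs) = insert (gs ! i) (set (take i gs))"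
    using i(1) by (simp add: take_Suc_conv_app_nth)
  let ?N = "mult_preimage I J (set (take i gs))"
  let ?N' = "mult_preimage I J (insert (gs ! i) (set (take i gs)))"
  have "\<exists>z. (\<forall>b. z b \<in> I) \<and> (\<forall>b. y b - kos x z b \<in> ?N)"
  proof (rule koszul_step[where N' = ?N' and g = "gs ! i" and m = k])
    show "\<exists>h\<in>I. f - gs ! i * h \<in> ?N" if "f \<in> ?N'" for f
      using mult_preimage_insert[OF I that] by blast
    show "f \<in> ?N" if "f \<in> I" "gs ! i * f \<in> ?N" for f
      using reg that i(1) unfolding regular_sequence_def by blast
    show "gs ! i \<in> ideal.span (range x)" using gs i(1) by auto
    show "\<exists>z. (\<forall>b. z b \<in> I) \<and> (\<forall>b. y b - kos x z b \<in> ?N')"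
      if "\<And>b. y b \<in> I" "\<And>b. k \<le> card b \<Longrightarrow> y b = 0" "\<And>b. kos x y b \<in> ?N'" for y
      using Suc.IH[of y] Suc.prems(1) that unfolding i(2) take by simp
    show "?N \<subseteq> ?N'" by (rule mult_preimage_mono) blast
    show "gs ! i * f \<in> ?N'" if "f \<in> I" for f using that by (intro mult_preimage_mult) auto
  qed (use Suc.prems I mult_preimage_subspace in \<open>auto simp: i_def\<close>)
  then show ?case by (simp add: i_def)
qed

subsection \<open>Squarefree monomial ideals\<close>

text \<open>For upward closed \<open>U\<close> these are the squarefree monomial ideals, so
  \<open>I\<close> and \<open>J\<close> turn into families of sets.\<close>

definition supported_on :: "'n set set \<Rightarrow> ('n, 'k::field) mpoly set" where
  "supported_on U = {f. \<forall>t\<in>Poly_Mapping.keys f. Poly_Mapping.keys t \<in> U}"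

lemma supported_on_iff:
  "f \<in> supported_on U \<longleftrightarrow> (\<forall>t. Poly_Mapping.keys t \<notin> U \<longrightarrow> Poly_Mapping.lookup f t = 0)"
  by (auto simp: supported_on_def in_keys_iff)

definition expo_of :: "'n::finite set \<Rightarrow> 'n expo" where
  "expo_of A = Abs_poly_mapping (\<lambda>i. if i \<in> A then 1 else 0)"

lemma lookup_expo_of [simp]: "Poly_Mapping.lookup (expo_of A) i = (if i \<in> A then 1 else 0)"
  by (simp add: expo_of_def)

lemma keys_expo_of [simp]: "Poly_Mapping.keys (expo_of A) = A"
  by (auto simp: in_keys_iff split: if_splits)

lemma expo_of_keys:
  assumes "sqfree t"
  shows "expo_of (Poly_Mapping.keys t) = t"
proof (rule poly_mapping_eqI)
  fix k
  have "Poly_Mapping.lookup t k \<le> 1" using assms by (simp add: sqfree_def)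
  then show "Poly_Mapping.lookup (expo_of (Poly_Mapping.keys t)) k = Poly_Mapping.lookup t k"
    by (cases "Poly_Mapping.lookup t k") (auto simp: in_keys_iff)
qed

lemma deg_sqfree:
  fixes t :: "'n::finite expo"
  assumes "sqfree t"
  shows "deg t = card (Poly_Mapping.keys t)"
proof -
  have "deg t = deg (expo_of (Poly_Mapping.keys t))" using expo_of_keys[OF assms] by simp
  also have "\<dots> = card (Poly_Mapping.keys t)" by (simp add: deg_def sum.If_cases)
  finally show ?thesis .
qed

lemma single_plus_expo_of:
  "j \<in> A \<Longrightarrow> Poly_Mapping.single j 1 + expo_of (A - {j}) = expo_of A"
  by (rule poly_mapping_eqI) (auto simp: lookup_add lookup_single when_def)

lemma keys_add_expo:
  fixes s t :: "'n expo"
  shows "Poly_Mapping.keys (s + t) = Poly_Mapping.keys s \<union> Poly_Mapping.keys t"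
  by (auto simp: in_keys_iff lookup_add)

lemma sum_single_keys:
  fixes f :: "'a \<Rightarrow>\<^sub>0 'b::comm_monoid_add"
  shows "f = (\<Sum>t\<in>Poly_Mapping.keys f. Poly_Mapping.single t (Poly_Mapping.lookup f t))"
  by (rule poly_mapping_eqI)
    (auto simp: lookup_sum lookup_single when_def in_keys_iff sum.delta' if_distrib cong: if_cong)

lemma lookup_monom_mult:
  fixes f :: "('n, 'k::field) mpoly"
  shows "Poly_Mapping.lookup (monom s * f) u =
    (\<Sum>t\<in>Poly_Mapping.keys f. if s + t = u then Poly_Mapping.lookup f t else 0)"
proof -
  have "monom s * f = (\<Sum>t\<in>Poly_Mapping.keys f. Poly_Mapping.single (s + t) (Poly_Mapping.lookup f t))"
    by (subst sum_single_keys[of f]) (simp add: monom_def sum_distrib_left mult_single)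
  then show ?thesis by (simp add: lookup_sum lookup_single when_def)
qed

lemma lookup_monom_mult_add [simp]:
  fixes f :: "('n, 'k::field) mpoly"
  shows "Poly_Mapping.lookup (monom s * f) (s + t) = Poly_Mapping.lookup f t"
  by (simp add: lookup_monom_mult in_keys_iff)

lemma keys_monom_mult:
  fixes f :: "('n, 'k::field) mpoly"
  shows "Poly_Mapping.keys (monom s * f) = (\<lambda>t. s + t) ` Poly_Mapping.keys f"
proof (intro equalityI subsetI)
  fix u assume "u \<in> Poly_Mapping.keys (monom s * f)"
  then have "(\<Sum>t\<in>Poly_Mapping.keys f. if s + t = u then Poly_Mapping.lookup f t else 0) \<noteq> 0"
    by (simp add: in_keys_iff lookup_monom_mult)
  then obtain t where "t \<in> Poly_Mapping.keys f" "(if s + t = u then Poly_Mapping.lookup f t else 0) \<noteq> 0"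
    by (rule sum.not_neutral_contains_not_neutral)
  then have "t \<in> Poly_Mapping.keys f" "u = s + t" by (simp_all split: if_splits)
  then show "u \<in> (\<lambda>t. s + t) ` Poly_Mapping.keys f" by blast
qed (auto simp: in_keys_iff)

lemma lookup_var_mult:
  fixes f :: "('n::finite, 'k::field) mpoly"
  shows "j \<in> A \<Longrightarrow> Poly_Mapping.lookup (var j * f) (expo_of A) = Poly_Mapping.lookup f (expo_of (A - {j}))"
    and "j \<notin> A \<Longrightarrow> Poly_Mapping.lookup (var j * f) (expo_of A) = 0"
proof -
  show "Poly_Mapping.lookup (var j * f) (expo_of A) = Poly_Mapping.lookup f (expo_of (A - {j}))" if "j \<in> A"
    unfolding var_def single_plus_expo_of[OF that, symmetric] by (rule lookup_monom_mult_add)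
  show "Poly_Mapping.lookup (var j * f) (expo_of A) = 0" if "j \<notin> A"
  proof (rule ccontr)
    assume "\<not> ?thesis"
    then have "expo_of A \<in> Poly_Mapping.keys (var j * f)" by (simp add: in_keys_iff)
    then obtain t where "expo_of A = Poly_Mapping.single j 1 + t"
      unfolding var_def keys_monom_mult by blast
    then have "Poly_Mapping.keys (expo_of A) = Poly_Mapping.keys (Poly_Mapping.single j (1::nat) + t)"
      by simp
    then show False using that unfolding keys_add_expo by auto
  qed
qed

lemma supported_on_subspace:
  fixes U :: "'n::finite set set"
  assumes "\<And>A B. A \<in> U \<Longrightarrow> A \<subseteq> B \<Longrightarrow> B \<in> U"
  shows "ideal.subspace (supported_on U :: ('n, 'k::field) mpoly set)"
  unfolding ideal.subspace_def
proof (intro conjI ballI allI)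
  show "f + g \<in> supported_on U" if "f \<in> supported_on U" "g \<in> supported_on U" for f g :: "('n, 'k) mpoly"
    using that by (auto simp: supported_on_iff lookup_add)
  show "r * f \<in> supported_on U" if f: "f \<in> supported_on U" for r f :: "('n, 'k) mpoly"
    unfolding supported_on_def
  proof (intro CollectI ballI)
    fix u assume "u \<in> Poly_Mapping.keys (r * f)"
    then obtain s t where u: "u = s + t" and "t \<in> Poly_Mapping.keys f" using keys_mult[of r f] by blast
    then have "Poly_Mapping.keys t \<in> U" using f by (simp add: supported_on_def)
    then show "Poly_Mapping.keys u \<in> U" unfolding u keys_add_expo by (rule assms) blast
  qed
qed (simp add: supported_on_def)

text \<open>A squarefree monomial divides another monomial exactly when its support is contained in
  the other's.\<close>

lemma span_monom:
  fixes G :: "'n::finite expo set"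
  assumes G: "\<And>t. t \<in> G \<Longrightarrow> sqfree t"
  shows "ideal.span (monom ` G) =
    (supported_on {A. \<exists>t\<in>G. Poly_Mapping.keys t \<subseteq> A} :: ('n, 'k::field) mpoly set)"
proof (intro equalityI)
  let ?U = "{A. \<exists>t\<in>G. Poly_Mapping.keys t \<subseteq> A}"
  show "ideal.span (monom ` G) \<subseteq> (supported_on ?U :: ('n, 'k) mpoly set)"
  proof (rule ideal.span_minimal)
    show "monom ` G \<subseteq> (supported_on ?U :: ('n, 'k) mpoly set)"
      by (auto simp: supported_on_def monom_def split: if_splits)
    show "ideal.subspace (supported_on ?U :: ('n, 'k) mpoly set)"
      by (rule supported_on_subspace) blast
  qed
  show "(supported_on ?U :: ('n, 'k) mpoly set) \<subseteq> ideal.span (monom ` G)"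
  proof
    fix f :: "('n, 'k) mpoly" assume f: "f \<in> supported_on ?U"
    have "(\<Sum>t\<in>Poly_Mapping.keys f. Poly_Mapping.single t (Poly_Mapping.lookup f t)) \<in> ideal.span (monom ` G)"
    proof (rule ideal.span_sum)
      fix t assume "t \<in> Poly_Mapping.keys f"
      then obtain s where s: "s \<in> G" "Poly_Mapping.keys s \<subseteq> Poly_Mapping.keys t"
        using f unfolding supported_on_def by blast
      have "Poly_Mapping.lookup s i \<le> Poly_Mapping.lookup t i" for i
      proof (cases "i \<in> Poly_Mapping.keys s")
        case True
        then have "i \<in> Poly_Mapping.keys t" using s(2) by blast
        then have "1 \<le> Poly_Mapping.lookup t i" by (simp add: in_keys_iff)
        moreover have "Poly_Mapping.lookup s i \<le> 1" using G[OF s(1)] by (simp add: sqfree_def)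
        ultimately show ?thesis by simp
      qed (simp add: in_keys_iff)
      then have "t = (t - s) + s"
        by (intro poly_mapping_eqI) (simp add: lookup_add lookup_minus)
      then have "Poly_Mapping.single t (Poly_Mapping.lookup f t) =
          Poly_Mapping.single (t - s) (Poly_Mapping.lookup f t) * (monom s :: ('n, 'k) mpoly)"
        by (metis monom_def mult_single mult.right_neutral)
      moreover have "(monom s :: ('n, 'k) mpoly) \<in> ideal.span (monom ` G)"
        using s(1) by (intro ideal.span_base) blast
      ultimately show "Poly_Mapping.single t (Poly_Mapping.lookup f t) \<in> ideal.span (monom ` G)"
        by (simp add: ideal.span_scale)
    qed
    then show "f \<in> ideal.span (monom ` G)" by (simp flip: sum_single_keys)
  qed
qed

lemma single_in_supported_on:
  "A \<in> U \<or> a = 0 \<Longrightarrow> Poly_Mapping.single (expo_of A) a \<in> supported_on U"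
  by (auto simp: supported_on_def split: if_splits)

lemma var_mult_single:
  "j \<in> A \<Longrightarrow> var j * Poly_Mapping.single (expo_of (A - {j})) a = Poly_Mapping.single (expo_of A) (a :: 'k::field)"
  unfolding var_def monom_def mult_single by (simp only: single_plus_expo_of mult_1_left)

lemma inc_mult_single:
  "inc j b * Poly_Mapping.single t a = (Poly_Mapping.single t (inc j b * a) :: ('n::finite, 'k::field) mpoly)"
  by (cases "even (card {k\<in>b. to_nat k < to_nat j})") (simp_all add: inc_def single_uminus)

lemma lookup_inc_mult:
  "Poly_Mapping.lookup (inc j b * f) t = inc j b * Poly_Mapping.lookup (f :: ('n::finite, 'k::field) mpoly) t"
  by (cases "even (card {k\<in>b. to_nat k < to_nat j})") (simp_all add: inc_def)

text \<open>
  The homology of the Koszul complex of \<open>I/J\<close> is read off in the degrees \<open>UNIV\<close> (for exactness and for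
  \<open>proper\<close>) and \<open>UNIV - {v}\<close> (for \<open>vanish\<close>).
\<close>

lemma three_levels_of_regular_sequence:
  fixes U V :: "'n::finite set set"
  defines "I \<equiv> supported_on U :: ('n, 'k::field) mpoly set" and "J \<equiv> supported_on V"
  assumes U: "\<And>A B. A \<in> U \<Longrightarrow> A \<subseteq> B \<Longrightarrow> B \<in> U" and V: "\<And>A B. A \<in> V \<Longrightarrow> A \<subseteq> B \<Longrightarrow> B \<in> V"
    and cardU: "\<And>A. A \<in> U \<Longrightarrow> d \<le> card A" and cardV: "\<And>A. A \<in> V \<Longrightarrow> Suc d \<le> card A"
    and "d > 0"
    and reg: "regular_sequence I J gs" and gs: "set gs \<subseteq> ideal.span (range var)"
    and len: "Suc (Suc d) \<le> length gs"
  shows "three_levels TYPE('k) {A\<in>U. card A = d} {A\<in>U - V. card A = Suc d}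
      {A\<in>U - V. card A = Suc (Suc d)} d"
    and "three_levels.exact TYPE('k) {A\<in>U - V. card A = Suc d}
      {A\<in>U. card A = d} {A\<in>U - V. card A = Suc d} {A\<in>U - V. card A = Suc (Suc d)}"
proof -
  let ?F = "{A\<in>U. card A = d}"
  let ?B = "{A\<in>U - V. card A = Suc d}"
  let ?C = "{A\<in>U - V. card A = Suc (Suc d)}"
  have I: "ideal.subspace I" and J: "ideal.subspace J"
    unfolding I_def J_def using U V by (auto intro: supported_on_subspace)
  have acyclic: "\<exists>z. (\<forall>b. z b \<in> I) \<and> (\<forall>b. y b - kos var z b \<in> J)"
    if "\<And>b. y b \<in> I" "\<And>b. Suc (Suc d) \<le> card b \<Longrightarrow> y b = 0" "\<And>b. kos var y b \<in> J" for y
  proof -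
    have "mult_preimage I J (set (take (length gs - length gs) gs)) = J"
      using J by (simp add: mult_preimage_def ideal.span_eq_iff)
    then show ?thesis
      using koszul_regular[OF I reg gs order.refl, of y] that len by auto
  qed
  have coeffI: "Poly_Mapping.lookup f (expo_of A) = 0" if "f \<in> I" "A \<notin> U" for f A
    using that by (simp add: I_def supported_on_iff)
  have coeff: "Poly_Mapping.lookup (y b) (expo_of A) = Poly_Mapping.lookup (kos var z b) (expo_of A)"
    if "y b - kos var z b \<in> J" "A \<notin> V" for y z :: "'n set \<Rightarrow> ('n, 'k) mpoly" and b A
    using that by (simp add: J_def supported_on_iff lookup_minus)
  have kos_coeff: "Poly_Mapping.lookup (kos var z b) (expo_of A) =
      (\<Sum>j\<in>b. inc j b * (if j \<in> A then Poly_Mapping.lookup (z (b - {j})) (expo_of (A - {j})) else 0))"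
    for z :: "'n set \<Rightarrow> ('n, 'k) mpoly" and b A
    unfolding kos_def lookup_sum mult.assoc lookup_inc_mult
    by (intro sum.cong refl) (simp add: lookup_var_mult)
  \<comment> \<open>Such a coefficient is built from coefficients at sets of size below d, and
    \<open>U\<close> has none.\<close>
  have low: "Poly_Mapping.lookup (kos var z b) (expo_of A) = 0"
    if "card A = d" "\<And>b. z b \<in> I" for z b A
    unfolding kos_coeff
  proof (rule sum.neutral, rule ballI)
    fix j
    have "A - {j} \<notin> U" if "j \<in> A"
    proof -
      have "card (A - {j}) < card A" using that by (intro psubset_card_mono) auto
      then show ?thesis using cardU[of "A - {j}"] \<open>card A = d\<close> by auto
    qed
    then show "inc j b * (if j \<in> A then Poly_Mapping.lookup (z (b - {j})) (expo_of (A - {j})) else 0) = 0"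
      using coeffI[OF that(2)] by simp
  qed
  have exact: "\<exists>\<alpha>. (\<forall>f. f \<notin> ?F \<longrightarrow> \<alpha> f = 0) \<and> (\<forall>b\<in>?B. y b = cob \<alpha> b)"
    if y: "\<forall>b. b \<notin> ?B \<longrightarrow> y b = 0" "\<forall>c\<in>?C. cob y c = 0" for y :: "'n set \<Rightarrow> 'k"
  proof -
    \<comment> \<open>Component \<open>b\<close> stands for the complement of \<open>b\<close>;
      together with the monomial of \<open>b\<close> the total degree is
      \<open>UNIV\<close>.\<close>
    define Y where "Y b = Poly_Mapping.single (expo_of b) (y b)" for b
    have kosY: "kos var Y c = Poly_Mapping.single (expo_of c) (cob y c)" for c
    proof -
      have "kos var Y c = (\<Sum>j\<in>c. Poly_Mapping.single (expo_of c) (inc j c * y (c - {j})))"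
        unfolding kos_def Y_def mult.assoc
        by (intro sum.cong refl) (simp add: var_mult_single inc_mult_single)
      also have "\<dots> = Poly_Mapping.single (expo_of c) (cob y c)"
        unfolding cob_def by (rule poly_mapping_eqI) (simp add: lookup_sum lookup_single when_def)
      finally show ?thesis .
    qed
    have "c \<in> V \<or> cob y c = 0" for c
    proof (cases "\<exists>j\<in>c. c - {j} \<in> ?B")
      case True
      then obtain j where j: "j \<in> c" "c - {j} \<in> ?B" by blast
      then have "c \<in> U" "card c = Suc (Suc d)" using U[of "c - {j}" c] by (auto simp: card_Diff_singleton)
      then show ?thesis using y(2) by blast
    next
      case False
      then show ?thesis using y(1) by (intro disjI2 cob_zero) blast
    qed
    then have "kos var Y b \<in> J" for b
      unfolding kosY J_def by (intro single_in_supported_on)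
    moreover have "Y b \<in> I" for b
      using y(1) unfolding Y_def I_def by (intro single_in_supported_on) blast
    moreover have "Y b = 0" if "Suc (Suc d) \<le> card b" for b
      using y(1) that by (auto simp: Y_def)
    ultimately have "\<exists>z. (\<forall>b. z b \<in> I) \<and> (\<forall>b. Y b - kos var z b \<in> J)" by (intro acyclic)
    then obtain z where z: "\<And>b. z b \<in> I" "\<And>b. Y b - kos var z b \<in> J" by blast
    define \<alpha> where "\<alpha> f = (if f \<in> ?F then Poly_Mapping.lookup (z f) (expo_of f) else 0)" for f
    have "y b = cob \<alpha> b" if b: "b \<in> ?B" for b
    proof -
      have "y b = Poly_Mapping.lookup (Y b) (expo_of b)" by (simp add: Y_def)
      also have "\<dots> = Poly_Mapping.lookup (kos var z b) (expo_of b)"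
        by (rule coeff[OF z(2)]) (use b in auto)
      also have "\<dots> = cob \<alpha> b"
        unfolding kos_coeff cob_def
      proof (rule sum.cong)
        fix j assume j: "j \<in> b"
        then have "card (b - {j}) = d" using b by simp
        then have "Poly_Mapping.lookup (z (b - {j})) (expo_of (b - {j})) = \<alpha> (b - {j})"
          using coeffI[OF z(1)] by (auto simp: \<alpha>_def)
        then show "inc j b * (if j \<in> b then Poly_Mapping.lookup (z (b - {j})) (expo_of (b - {j})) else 0) =
            inc j b * \<alpha> (b - {j})"
          using j by simp
      qed simp
      finally show ?thesis .
    qed
    then show ?thesis by (intro exI[of _ \<alpha>]) (auto simp: \<alpha>_def)
  qed
  have vanish: "\<alpha> f = 0"
    if \<alpha>: "\<And>f. f \<notin> ?F \<Longrightarrow> \<alpha> f = 0" "\<And>b. b \<in> ?B \<Longrightarrow> v \<notin> b \<Longrightarrow> cob \<alpha> b = 0"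
      and f: "f \<in> ?F" "v \<notin> f" for \<alpha> :: "'n set \<Rightarrow> 'k" and v f
  proof -
    \<comment> \<open>The total degree is now \<open>UNIV - {v}\<close>. The sign makes the
      differential at \<open>c\<close> a multiple of \<open>cob \<alpha>\<close> on
      \<open>c - {v}\<close>.\<close>
    define Y where "Y b = (if v \<in> b then Poly_Mapping.single (expo_of (b - {v})) (inc v b * \<alpha> (b - {v})) else 0)"
      for b
    have kosY: "kos var Y c =
        (if v \<in> c then Poly_Mapping.single (expo_of (c - {v})) (- inc v c * cob \<alpha> (c - {v})) else 0)" for c
    proof (cases "v \<in> c")
      case True
      have "kos var Y c = (\<Sum>j\<in>c - {v}. inc j c * var j * Y (c - {j}))"
        unfolding kos_def by (rule sum.mono_neutral_right) (auto simp: Y_def)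
      also have "\<dots> = (\<Sum>j\<in>c - {v}. Poly_Mapping.single (expo_of (c - {v}))
          (- inc v c * (inc j (c - {v}) * \<alpha> (c - {v} - {j}))))"
      proof (rule sum.cong)
        fix j assume j: "j \<in> c - {v}"
        have eq: "c - {j} - {v} = c - {v} - {j}" by auto
        have "inc j c * inc v (c - {j}) = - (inc v c * inc j (c - {v}) :: 'k)"
          by (rule inc_swap) (use j True in auto)
        then have s: "inc j c * (inc v (c - {j}) * a) = - inc v c * (inc j (c - {v}) * a)" for a :: 'k
          by (simp flip: mult.assoc)
        have "Y (c - {j}) = Poly_Mapping.single (expo_of (c - {v} - {j})) (inc v (c - {j}) * \<alpha> (c - {v} - {j}))"
          using True j by (auto simp: Y_def eq)
        then show "inc j c * var j * Y (c - {j}) = Poly_Mapping.single (expo_of (c - {v}))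
            (- inc v c * (inc j (c - {v}) * \<alpha> (c - {v} - {j})))"
          using j by (simp only: mult.assoc var_mult_single inc_mult_single s)
      qed simp
      also have "\<dots> = Poly_Mapping.single (expo_of (c - {v})) (- inc v c * cob \<alpha> (c - {v}))"
        unfolding cob_def by (rule poly_mapping_eqI) (simp add: lookup_sum lookup_single when_def sum_distrib_left)
      finally show ?thesis using True by simp
    next
      case False
      then show ?thesis by (simp add: kos_def Y_def)
    qed
    have inV: "b \<in> V \<or> cob \<alpha> b = 0" if "v \<notin> b" for b
    proof (cases "\<exists>j\<in>b. b - {j} \<in> ?F")
      case True
      then obtain j where j: "j \<in> b" "b - {j} \<in> ?F" by blast
      have "Suc (card (b - {j})) = card b" by (rule card_Suc_Diff1) (use j in auto)
      then have "b \<in> U" "card b = Suc d" using j U[of "b - {j}" b] by auto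
      then show ?thesis using \<alpha>(2) that by blast
    next
      case False
      then show ?thesis using \<alpha>(1) by (intro disjI2 cob_zero) blast
    qed
    have "kos var Y b \<in> J" for b
      using inV[of "b - {v}"] ideal.subspace_0[OF J] unfolding kosY J_def
      by (auto intro!: single_in_supported_on)
    moreover have "Y b \<in> I" for b
    proof -
      have "b - {v} \<in> U \<or> \<alpha> (b - {v}) = 0" using \<alpha>(1)[of "b - {v}"] by blast
      then show ?thesis
        using ideal.subspace_0[OF I] unfolding Y_def I_def by (auto intro!: single_in_supported_on)
    qed
    moreover have "Y b = 0" if "Suc (Suc d) \<le> card b" for b
    proof (cases "v \<in> b")
      case True
      then have "\<alpha> (b - {v}) = 0" using that by (intro \<alpha>(1)) auto
      then show ?thesis by (simp add: Y_def)
    qed (simp add: Y_def)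
    ultimately have "\<exists>z. (\<forall>b. z b \<in> I) \<and> (\<forall>b. Y b - kos var z b \<in> J)" by (intro acyclic)
    then obtain z where z: "\<And>b. z b \<in> I" "\<And>b. Y b - kos var z b \<in> J" by blast
    \<comment> \<open>Members of \<open>V\<close> are larger than \<open>f\<close>, so the
      coefficient at \<open>f\<close> survives modulo \<open>J\<close>; by \<open>low\<close> a
      boundary has none.\<close>
    have "f \<notin> V" using cardV f by force
    have "inc v (insert v f) * \<alpha> f = Poly_Mapping.lookup (Y (insert v f)) (expo_of f)"
      using f by (simp add: Y_def)
    also have "\<dots> = 0"
      using coeff[of Y "insert v f" z f, OF z(2) \<open>f \<notin> V\<close>] low[of f z] z(1) f by simp
    finally show ?thesis by simp
  qed
  have proper: "UNIV \<notin> ?F"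
  proof
    assume F: "UNIV \<in> ?F"
    \<comment> \<open>This is a cycle because no component lies above \<open>UNIV\<close>, and
      \<open>low\<close> prevents it from being a boundary.\<close>
    define Y :: "'n set \<Rightarrow> ('n, 'k) mpoly" where "Y b = (if b = UNIV then monom (expo_of UNIV) else 0)" for b
    have "Y b \<in> I" for b
      using F ideal.subspace_0[OF I] by (auto simp: Y_def monom_def I_def intro!: single_in_supported_on)
    moreover have "Y b = 0" if "Suc (Suc d) \<le> card b" for b
      using F that by (auto simp: Y_def)
    moreover have "kos var Y b \<in> J" for b
    proof -
      have "kos var Y b = 0" unfolding kos_def by (rule sum.neutral) (auto simp: Y_def)
      then show ?thesis using ideal.subspace_0[OF J] by simp
    qed
    ultimately have "\<exists>z. (\<forall>b. z b \<in> I) \<and> (\<forall>b. Y b - kos var z b \<in> J)" by (intro acyclic)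
    then obtain z where z: "\<And>b. z b \<in> I" "\<And>b. Y b - kos var z b \<in> J" by blast
    have "UNIV \<notin> V" using cardV F by force
    have "Poly_Mapping.lookup (Y UNIV) (expo_of UNIV) = 0"
      using coeff[of Y UNIV z UNIV, OF z(2) \<open>UNIV \<notin> V\<close>] low[of UNIV z] z(1) F by simp
    then show False by (simp add: Y_def monom_def)
  qed
  show tl: "three_levels TYPE('k) ?F ?B ?C d"
  proof
    show "b \<in> ?B" if "f \<in> ?F" "c \<in> ?C" "f \<subseteq> b" "b \<subseteq> c" "card b = Suc d" for f b c
      using that U[of f b] V[of b c] by blast
    show "f \<noteq> UNIV" if "f \<in> ?F" for f using that proper by blast
    show "\<alpha> f = 0"
      if "\<And>f. f \<notin> ?F \<Longrightarrow> \<alpha> f = 0" "\<And>b. b \<in> ?B \<Longrightarrow> v \<notin> b \<Longrightarrow> cob \<alpha> b = 0" "f \<in> ?F" "v \<notin> f"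
      for \<alpha> :: "'n set \<Rightarrow> 'k" and v f
      using that by (rule vanish)
  qed auto
  interpret three_levels ?F ?B ?C d "TYPE('k)" by (rule tl)
  show "exact ?F ?B ?C" unfolding exact_def using exact by blast
qed

subsection \<open>Stanley decompositions from interval partitions\<close>

definition restrict_keys :: "('a \<Rightarrow>\<^sub>0 'b::comm_monoid_add) \<Rightarrow> 'a set \<Rightarrow> 'a \<Rightarrow>\<^sub>0 'b" where
  "restrict_keys f T = (\<Sum>t\<in>Poly_Mapping.keys f \<inter> T. Poly_Mapping.single t (Poly_Mapping.lookup f t))"

lemma lookup_restrict_keys:
  "Poly_Mapping.lookup (restrict_keys f T) t = (if t \<in> T then Poly_Mapping.lookup f t else 0)"
  by (auto simp: restrict_keys_def lookup_sum lookup_single when_def in_keys_iff)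

text \<open>Exponents of variables in \<open>Z\<close> can be raised freely, so the space is
  determined by supports, which run through the interval from \<open>A\<close> to
  \<open>Z\<close>.\<close>

lemma stanley_space_eq:
  fixes A Z :: "'n::finite set"
  assumes "A \<subseteq> Z"
  shows "stanley_space (expo_of A) Z =
    {f :: ('n, 'k::field) mpoly. \<forall>t\<in>Poly_Mapping.keys f. A \<subseteq> Poly_Mapping.keys t \<and> Poly_Mapping.keys t \<subseteq> Z}"
proof (intro equalityI subsetI)
  fix f :: "('n, 'k) mpoly" assume "f \<in> stanley_space (expo_of A) Z"
  then obtain g :: "('n, 'k) mpoly" where g: "g \<in> poly_in Z" "f = monom (expo_of A) * g"
    by (auto simp: stanley_space_def)
  have "\<forall>t\<in>Poly_Mapping.keys f. A \<subseteq> Poly_Mapping.keys t \<and> Poly_Mapping.keys t \<subseteq> Z"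
    using g(1) assms unfolding g(2) keys_monom_mult poly_in_def
    by (auto simp: keys_add_expo)
  then show "f \<in> {f. \<forall>t\<in>Poly_Mapping.keys f. A \<subseteq> Poly_Mapping.keys t \<and> Poly_Mapping.keys t \<subseteq> Z}"
    by simp
next
  fix f :: "('n, 'k) mpoly"
  assume f: "f \<in> {f. \<forall>t\<in>Poly_Mapping.keys f. A \<subseteq> Poly_Mapping.keys t \<and> Poly_Mapping.keys t \<subseteq> Z}"
  define g where "g = (\<Sum>t\<in>Poly_Mapping.keys f. Poly_Mapping.single (t - expo_of A) (Poly_Mapping.lookup f t))"
  have "expo_of A + (t - expo_of A) = t" if "t \<in> Poly_Mapping.keys f" for t
  proof (rule poly_mapping_eqI)
    fix i
    have "A \<subseteq> Poly_Mapping.keys t" using f that by blast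
    then have "i \<in> A \<Longrightarrow> 0 < Poly_Mapping.lookup t i" by (auto simp: in_keys_iff)
    then show "Poly_Mapping.lookup (expo_of A + (t - expo_of A)) i = Poly_Mapping.lookup t i"
      by (simp add: lookup_add lookup_minus)
  qed
  then have "monom (expo_of A) * g = (\<Sum>t\<in>Poly_Mapping.keys f. Poly_Mapping.single t (Poly_Mapping.lookup f t))"
    unfolding g_def sum_distrib_left by (intro sum.cong refl) (simp add: monom_def mult_single)
  then have "f = monom (expo_of A) * g" by (simp flip: sum_single_keys)
  moreover have "g \<in> poly_in Z"
    unfolding poly_in_def
  proof (intro CollectI ballI)
    fix u assume "u \<in> Poly_Mapping.keys g"
    then have "(\<Sum>t\<in>Poly_Mapping.keys f.
        Poly_Mapping.lookup (Poly_Mapping.single (t - expo_of A) (Poly_Mapping.lookup f t)) u) \<noteq> 0"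
      by (simp add: in_keys_iff g_def lookup_sum)
    then obtain t where "t \<in> Poly_Mapping.keys f"
      "Poly_Mapping.lookup (Poly_Mapping.single (t - expo_of A) (Poly_Mapping.lookup f t)) u \<noteq> 0"
      by (rule sum.not_neutral_contains_not_neutral)
    then have t: "t \<in> Poly_Mapping.keys f" "u = t - expo_of A"
      by (simp_all add: lookup_single when_def split: if_splits)
    then have "Poly_Mapping.keys u \<subseteq> Poly_Mapping.keys t"
      by (auto simp: in_keys_iff lookup_minus)
    then show "Poly_Mapping.keys u \<subseteq> Z" using f t(1) by blast
  qed
  ultimately show "f \<in> stanley_space (expo_of A) Z" by (auto simp: stanley_space_def)
qed

text \<open>The supports of monomials that survive in the quotient form \<open>U - V\<close>; a
  partition of it into intervals sorts these monomials into Stanley spaces.\<close>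

lemma stanley_decomposition_of_partition:
  fixes U V :: "'n::finite set set" and top :: "'n set \<Rightarrow> 'n set"
  assumes U: "\<And>A B. A \<in> U \<Longrightarrow> A \<subseteq> B \<Longrightarrow> B \<in> U" and V: "\<And>A B. A \<in> V \<Longrightarrow> A \<subseteq> B \<Longrightarrow> B \<in> V"
    and top: "\<And>A. A \<in> X \<Longrightarrow> A \<in> U" "\<And>A. A \<in> X \<Longrightarrow> A \<subseteq> top A" "\<And>A. A \<in> X \<Longrightarrow> top A \<notin> V"
    and cover: "\<And>p. p \<in> U \<Longrightarrow> p \<notin> V \<Longrightarrow> \<exists>A\<in>X. A \<subseteq> p \<and> p \<subseteq> top A"
    and disj: "\<And>p A A'. A \<in> X \<Longrightarrow> A' \<in> X \<Longrightarrow> A \<subseteq> p \<Longrightarrow> p \<subseteq> top A \<Longrightarrow> A' \<subseteq> p \<Longrightarrow> p \<subseteq> top A' \<Longrightarrow> A = A'"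
    and D: "set D = (\<lambda>A. (expo_of A, top A)) ` X" "distinct D"
  shows "stanley_decomposition (supported_on U :: ('n, 'k::field) mpoly set) (supported_on V) D"
proof -
  let ?I = "supported_on U :: ('n, 'k) mpoly set" and ?J = "supported_on V :: ('n, 'k) mpoly set"
  have X: "p \<in> U - V" if "A \<in> X" "A \<subseteq> p" "p \<subseteq> top A" for A p
    using that U[OF top(1)] V[of p "top A"] top(3) by blast
  obtain a where a: "\<And>i. i < length D \<Longrightarrow> a i \<in> X" "\<And>i. i < length D \<Longrightarrow> D ! i = (expo_of (a i), top (a i))"
  proof -
    have "\<forall>i. \<exists>A. i < length D \<longrightarrow> A \<in> X \<and> D ! i = (expo_of A, top A)"
      using D(1) nth_mem[of _ D] by blast
    then show ?thesis using that by metis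
  qed
  have a_inj: "i = j" if "i < length D" "j < length D" "a i = a j" for i j
    using that a(2) D(2) by (metis nth_eq_iff_index_eq)
  have a_surj: "\<exists>i<length D. a i = A" if "A \<in> X" for A
  proof -
    have "(expo_of A, top A) \<in> set D" using D(1) that by blast
    then obtain i where i: "i < length D" "D ! i = (expo_of A, top A)" by (auto simp: in_set_conv_nth)
    then have "expo_of (a i) = expo_of A" using a(2) by simp
    then have "a i = A" by (metis keys_expo_of)
    then show ?thesis using i(1) by blast
  qed
  have space: "stanley_space (fst (D ! i)) (snd (D ! i)) = {f :: ('n, 'k) mpoly.
      \<forall>t\<in>Poly_Mapping.keys f. a i \<subseteq> Poly_Mapping.keys t \<and> Poly_Mapping.keys t \<subseteq> top (a i)}"
    if "i < length D" for i
    using stanley_space_eq[OF top(2)[OF a(1)[OF that]]] a(2)[OF that] by simp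
  define T where "T i = {t :: 'n expo. a i \<subseteq> Poly_Mapping.keys t \<and> Poly_Mapping.keys t \<subseteq> top (a i)}" for i
  have T_disj: "i = j" if "i < length D" "j < length D" "t \<in> T i" "t \<in> T j" for i j t
    using that disj[OF a(1) a(1), of i j "Poly_Mapping.keys t"] a_inj by (auto simp: T_def)
  show ?thesis
    unfolding stanley_decomposition_def direct_sum_mod_def
  proof (intro conjI ballI allI impI)
    fix uZ assume "uZ \<in> set D"
    then obtain A where A: "A \<in> X" "uZ = (expo_of A, top A)" using D(1) by blast
    have AP: "A \<in> U - V" by (rule X[OF A(1)]) (use top(2)[OF A(1)] in auto)
    have "f = 0" if f: "f \<in> colon ?J (monom (expo_of A))" "f \<in> poly_in (top A)" for f
    proof (rule ccontr)
      assume "f \<noteq> 0"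
      then obtain t where t: "t \<in> Poly_Mapping.keys f"
        by (metis ex_in_conv in_keys_iff lookup_zero poly_mapping_eqI)
      then have "Poly_Mapping.keys t \<subseteq> top A" using f(2) by (simp add: poly_in_def)
      then have "Poly_Mapping.keys (expo_of A + t) \<notin> V"
        using X[OF A(1), of "A \<union> Poly_Mapping.keys t"] top(2)[OF A(1)] by (simp add: keys_add_expo)
      moreover have "expo_of A + t \<in> Poly_Mapping.keys (f * monom (expo_of A))"
        using t by (subst mult.commute) (simp add: keys_monom_mult)
      ultimately show False using f(1) by (auto simp: colon_def supported_on_def)
    qed
    moreover have "0 \<in> colon ?J (monom (expo_of A))" "0 \<in> poly_in (top A)"
      by (auto simp: colon_def supported_on_def poly_in_def)
    ultimately show "case uZ of (u, Z) \<Rightarrow> monom u \<in> ?I - ?J \<and> colon ?J (monom u) \<inter> poly_in Z = {0}"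
      using A AP by (auto simp: supported_on_def monom_def)
  next
    fix f :: "('n, 'k) mpoly" assume f: "f \<in> ?I"
    \<comment> \<open>The restrictions miss only monomials whose support lies in
      \<open>V\<close>.\<close>
    have "f - (\<Sum>i<length D. restrict_keys f (T i)) \<in> ?J"
      unfolding supported_on_iff
    proof (intro allI impI)
      fix t :: "'n expo" assume nV: "Poly_Mapping.keys t \<notin> V"
      show "Poly_Mapping.lookup (f - (\<Sum>i<length D. restrict_keys f (T i))) t = 0"
      proof (cases "Poly_Mapping.keys t \<in> U")
        case True
        obtain A where A: "A \<in> X" "A \<subseteq> Poly_Mapping.keys t" "Poly_Mapping.keys t \<subseteq> top A"
          using cover[OF True nV] by blast
        obtain i where "i < length D" "a i = A" using a_surj[OF A(1)] by blast
        then have i: "i < length D" "t \<in> T i" using A by (auto simp: T_def)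
        have "(\<Sum>j<length D. Poly_Mapping.lookup (restrict_keys f (T j)) t)
            = (\<Sum>j\<in>{i}. Poly_Mapping.lookup (restrict_keys f (T j)) t)"
          by (rule sum.mono_neutral_right) (use i T_disj in \<open>auto simp: lookup_restrict_keys\<close>)
        then show ?thesis using i(2) by (simp add: lookup_minus lookup_sum lookup_restrict_keys)
      next
        case False
        then have "Poly_Mapping.lookup f t = 0" using f by (simp add: supported_on_iff)
        then show ?thesis by (simp add: lookup_minus lookup_sum lookup_restrict_keys cong: if_cong)
      qed
    qed
    moreover have "restrict_keys f (T i) \<in> stanley_space (fst (D ! i)) (snd (D ! i))" if "i < length D" for i
    proof -
      have "a i \<subseteq> Poly_Mapping.keys t \<and> Poly_Mapping.keys t \<subseteq> top (a i)"
        if "t \<in> Poly_Mapping.keys (restrict_keys f (T i))" for t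
      proof -
        have "t \<in> T i" using that by (simp add: in_keys_iff lookup_restrict_keys split: if_splits)
        then show ?thesis by (simp add: T_def)
      qed
      then show ?thesis unfolding space[OF that] by blast
    qed
    ultimately show "\<exists>g. (\<forall>i<length D. g i \<in> stanley_space (fst (D ! i)) (snd (D ! i))) \<and>
        f - (\<Sum>i<length D. g i) \<in> ?J" by (intro exI[of _ "\<lambda>i. restrict_keys f (T i)"]) blast
  next
    fix g :: "nat \<Rightarrow> ('n, 'k) mpoly" and i
    assume g: "(\<forall>i<length D. g i \<in> stanley_space (fst (D ! i)) (snd (D ! i))) \<and> (\<Sum>i<length D. g i) \<in> ?J"
      and i: "i < length D"
    have off: "Poly_Mapping.lookup (g j) t = 0" if "j < length D" "t \<notin> T j" for j t
    proof -
      have "g j \<in> stanley_space (fst (D ! j)) (snd (D ! j))" using g that(1) by blast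
      then have "\<forall>t\<in>Poly_Mapping.keys (g j). t \<in> T j"
        unfolding space[OF that(1)] by (simp add: T_def)
      then show ?thesis using that(2) by (auto simp: in_keys_iff)
    qed
    show "g i \<in> ?J"
      unfolding supported_on_iff
    proof (intro allI impI)
      fix t :: "'n expo" assume nV: "Poly_Mapping.keys t \<notin> V"
      show "Poly_Mapping.lookup (g i) t = 0"
      proof (cases "t \<in> T i")
        case True
        have "Poly_Mapping.lookup (g j) t = 0" if "j < length D" "j \<noteq> i" for j
          using off[OF that(1), of t] T_disj[OF that(1) i _ True] that(2) by blast
        then have "(\<Sum>j<length D. Poly_Mapping.lookup (g j) t) = (\<Sum>j\<in>{i}. Poly_Mapping.lookup (g j) t)"
          using i by (intro sum.mono_neutral_right) auto
        moreover have "Poly_Mapping.lookup (\<Sum>j<length D. g j) t = 0"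
          using g nV by (simp add: supported_on_iff)
        ultimately show ?thesis by (simp add: lookup_sum)
      qed (rule off[OF i])
    qed
  qed
qed

lemma sdepth_ge:
  fixes I J :: "('n::finite, 'k::field) mpoly set"
  assumes D: "stanley_decomposition I J D" "D \<noteq> []" and Z: "\<And>u Z. (u, Z) \<in> set D \<Longrightarrow> m \<le> card Z"
  shows "m \<le> sdepth I J"
proof -
  \<comment> \<open>On the empty list \<open>sdepth_decomp\<close> is an unspecified minimum, so its
    value enters the bound as a constant.\<close>
  have "sdepth_decomp E \<le> max (card (UNIV :: 'n set)) (sdepth_decomp ([] :: ('n expo \<times> 'n set) list))"
    for E :: "('n expo \<times> 'n set) list"
  proof (cases "E = []")
    case False
    then have "sdepth_decomp E \<in> (\<lambda>(u, Z). card Z) ` set E"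
      unfolding sdepth_decomp_def by (intro Min_in) auto
    then obtain Z :: "'n set" where "sdepth_decomp E = card Z" by auto
    then show ?thesis by (simp add: card_mono max.coboundedI1)
  qed simp
  then have fin: "finite {sdepth_decomp D |D. stanley_decomposition I J D}"
    by (intro finite_subset[OF _ finite_atMost]) blast
  have "m \<le> sdepth_decomp D"
    unfolding sdepth_decomp_def using D(2) Z by (subst Min_ge_iff) auto
  also have "\<dots> \<le> sdepth I J"
    unfolding sdepth_def using fin D(1) by (intro Max_ge) auto
  finally show ?thesis .
qed

section \<open>Completing the matched tops to an interval partition\<close>

context three_levels
begin

lemma partition_of_tops:
  fixes U V :: "'n set set"
  assumes U: "\<And>A. A \<in> U \<Longrightarrow> d \<le> card A"
    and F: "F = {A\<in>U - V. card A = d}" and B: "B = {A\<in>U - V. card A = Suc d}"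
    and C: "C = {A\<in>U - V. card A = Suc (Suc d)}"
    and up: "\<And>A A'. A \<in> U \<Longrightarrow> A \<subseteq> A' \<Longrightarrow> A' \<in> U" "\<And>A A'. A \<in> V \<Longrightarrow> A \<subseteq> A' \<Longrightarrow> A' \<in> V"
    and tops: "tops F B C p m"
  obtains X top where "F \<subseteq> X" "\<And>A. A \<in> X \<Longrightarrow> A \<in> U" "\<And>A. A \<in> X \<Longrightarrow> A \<subseteq> top A"
    "\<And>A. A \<in> X \<Longrightarrow> top A \<notin> V" "\<And>A. A \<in> X \<Longrightarrow> Suc (Suc d) \<le> card (top A)"
    "\<And>q. q \<in> U \<Longrightarrow> q \<notin> V \<Longrightarrow> \<exists>A\<in>X. A \<subseteq> q \<and> q \<subseteq> top A"
    "\<And>q A A'. A \<in> X \<Longrightarrow> A' \<in> X \<Longrightarrow> A \<subseteq> q \<Longrightarrow> q \<subseteq> top A \<Longrightarrow> A' \<subseteq> q \<Longrightarrow> q \<subseteq> top A' \<Longrightarrow> A = A'"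
proof -
  define R where "R = rest F B p"
  \<comment> \<open>Sets of size at least d + 2 that are not yet a top become intervals with a
    single element.\<close>
  define S where "S = {q\<in>U - V. Suc (Suc d) \<le> card q \<and> q \<notin> p ` F \<and> q \<notin> m ` R}"
  define top where "top A = (if A \<in> F then p A else if A \<in> R then m A else A)" for A
  have t: "\<forall>f\<in>F. p f \<in> C \<and> f \<subseteq> p f" "inj_on p F"
    "\<forall>f\<in>F. \<forall>g\<in>F. \<forall>b\<in>B. f \<subseteq> b \<and> b \<subseteq> p f \<and> g \<subseteq> b \<and> b \<subseteq> p g \<longrightarrow> f = g"
    "\<forall>b\<in>R. m b \<in> C \<and> b \<subseteq> m b" "inj_on m R" "m ` R \<inter> p ` F = {}"
    using tops by (simp_all add: tops_def R_def)
  have RB: "R \<subseteq> B" by (auto simp: R_def rest_def)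
  have FR: "A \<notin> F" if "A \<in> R" for A using that RB F B by auto
  have FS: "A \<notin> F" and RS: "A \<notin> R" if "A \<in> S" for A
    using that RB F B by (auto simp: S_def)
  have topF: "top A = p A" if "A \<in> F" for A using that by (simp add: top_def)
  have topR: "top A = m A" if "A \<in> R" for A using that FR by (simp add: top_def)
  have topS: "top A = A" if "A \<in> S" for A using that FS RS by (simp add: top_def)
  have eqC: "q = c" if "c \<in> C" "q \<subseteq> c" "Suc (Suc d) \<le> card q" for q c
    using card_seteq[of c q] card_C[OF that(1)] that by auto
  have FX: "A = A'" if A: "A \<in> F" "A \<subseteq> q" "q \<subseteq> top A" and A': "A' \<in> F \<union> R \<union> S" "A' \<subseteq> q" "q \<subseteq> top A'" for A A' q
  proof -
    have pA: "p A \<in> C" "q \<subseteq> p A" using t(1) A topF by auto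
    have qP: "q \<in> U" "q \<notin> V" using up(1)[of A q] up(2)[of q "p A"] pA A F C by auto
    have cq: "d \<le> card q" using U qP by blast
    consider "A' \<in> F" | "A' \<in> R" | "A' \<in> S" using A' by blast
    then show ?thesis
    proof cases
      case 1
      have pA': "p A' \<in> C" "q \<subseteq> p A'" using t(1) 1 A' topF by auto
      \<comment> \<open>A common \<open>q\<close> of size d or d + 2 identifies \<open>A\<close> and
        \<open>A'\<close> by \<open>F_eq\<close> or by injectivity of \<open>p\<close>; the overlap
        condition in \<open>tops\<close> covers size d + 1.\<close>
      consider "card q = d" | "card q = Suc d" | "Suc (Suc d) \<le> card q" using cq by linarith
      then show ?thesis
      proof cases
        case 1
        then have "q \<in> F" using qP F by blast
        then show ?thesis using F_eq[of A q] F_eq[of A' q] A A' \<open>A' \<in> F\<close> by auto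
      next
        case 2
        then have "q \<in> B" using qP B by blast
        then show ?thesis using t(3) A(1,2) pA(2) \<open>A' \<in> F\<close> A'(2) pA'(2) by blast
      next
        case 3
        then have "p A = p A'" using eqC[OF pA] eqC[OF pA'] by simp
        then show ?thesis using t(2) A(1) \<open>A' \<in> F\<close> by (simp add: inj_on_def)
      qed
    next
      case 2
      have mA': "m A' \<in> C" "q \<subseteq> m A'" using t(4) 2 A' topR by auto
      have A'B: "A' \<in> B" using 2 RB by blast
      show ?thesis
      proof (cases "Suc (Suc d) \<le> card q")
        case True
        then have "p A = m A'" using eqC[OF pA] eqC[OF mA'] by simp
        then show ?thesis using t(6) A(1) 2 by auto
      next
        case False
        moreover have "Suc d \<le> card q" using card_mono[of q A'] A' card_B[OF A'B] by simp
        ultimately have "A' = q" using B_eq[OF card_B[OF A'B] _ A'(2)] by simp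
        then show ?thesis using 2 A(1,2) pA(2) by (auto simp: R_def rest_def)
      qed
    next
      case 3
      then have "q = A'" using A' topS by auto
      then have "q = p A" using eqC[OF pA] 3 by (simp add: S_def)
      then show ?thesis using 3 A(1) \<open>q = A'\<close> by (auto simp: S_def)
    qed
  qed
  have RX: "A = A'" if A: "A \<in> R" "A \<subseteq> q" "q \<subseteq> top A" and A': "A' \<in> R \<union> S" "A' \<subseteq> q" "q \<subseteq> top A'" for A A' q
  proof -
    have mA: "m A \<in> C" "q \<subseteq> m A" using t(4) A topR by auto
    have AB: "A \<in> B" using A RB by blast
    have cq: "Suc d \<le> card q" using card_mono[of q A] A card_B[OF AB] by simp
    consider "A' \<in> R" | "A' \<in> S" using A' by blast
    then show ?thesis
    proof cases
      case 1
      have mA': "m A' \<in> C" "q \<subseteq> m A'" using t(4) 1 A' topR by auto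
      have A'B: "A' \<in> B" using 1 RB by blast
      show ?thesis
      proof (cases "Suc (Suc d) \<le> card q")
        case True
        then have "m A = m A'" using eqC[OF mA] eqC[OF mA'] by simp
        then show ?thesis using t(5) A(1) 1 by (simp add: inj_on_def)
      next
        case False
        then have "card q = Suc d" using cq by simp
        then show ?thesis using B_eq[OF card_B[OF AB] _ A(2)] B_eq[OF card_B[OF A'B] _ A'(2)] by simp
      qed
    next
      case 2
      then have "q = A'" using A' topS by auto
      then have "q = m A" using eqC[OF mA] 2 by (simp add: S_def)
      then show ?thesis using 2 A(1) \<open>q = A'\<close> by (auto simp: S_def)
    qed
  qed
  show ?thesis
  proof (rule that[of "F \<union> R \<union> S" top])
    show "F \<subseteq> F \<union> R \<union> S" by blast
    show "A \<in> U" if "A \<in> F \<union> R \<union> S" for A using that F B RB by (auto simp: S_def)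
    have "A \<subseteq> top A \<and> (top A \<in> C \<or> top A \<in> S)" if "A \<in> F \<union> R \<union> S" for A
    proof -
      consider "A \<in> F" | "A \<in> R" | "A \<in> S" using \<open>A \<in> _\<close> by blast
      then show ?thesis using t(1,4) topF topR topS by cases simp_all
    qed
    note top = this
    show "A \<subseteq> top A" if "A \<in> F \<union> R \<union> S" for A using top[OF that] by blast
    show "top A \<notin> V" "Suc (Suc d) \<le> card (top A)" if "A \<in> F \<union> R \<union> S" for A
      using top[OF that] C by (auto simp: S_def)
    show "\<exists>A\<in>F \<union> R \<union> S. A \<subseteq> q \<and> q \<subseteq> top A" if q: "q \<in> U" "q \<notin> V" for q
    proof -
      consider "card q = d" | "card q = Suc d" | "Suc (Suc d) \<le> card q" using U[OF q(1)] by linarith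
      then show ?thesis
      proof cases
        case 1
        then have "q \<in> F" using q F by blast
        then show ?thesis using t(1) topF by (intro bexI[of _ q]) auto
      next
        case 2
        then have "q \<in> B" using q B by blast
        show ?thesis
        proof (cases "q \<in> R")
          case True
          then show ?thesis using t(4) topR by (intro bexI[of _ q]) auto
        next
          case False
          then obtain f where "f \<in> F" "f \<subseteq> q" "q \<subseteq> p f"
            using \<open>q \<in> B\<close> by (auto simp: R_def rest_def)
          then show ?thesis using topF by (intro bexI[of _ f]) auto
        qed
      next
        case 3
        consider f where "f \<in> F" "q = p f" | b where "b \<in> R" "q = m b" | "q \<in> S"
          using q 3 by (auto simp: S_def)
        then show ?thesis
        proof cases
          case (1 f)
          then show ?thesis using t(1) topF by (intro bexI[of _ f]) auto
        next
          case (2 b)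
          then show ?thesis using t(4) topR by (intro bexI[of _ b]) auto
        next
          case 3
          then show ?thesis using topS by (intro bexI[of _ q]) auto
        qed
      qed
    qed
    show "A = A'"
      if AA': "A \<in> F \<union> R \<union> S" "A' \<in> F \<union> R \<union> S" "A \<subseteq> q" "q \<subseteq> top A" "A' \<subseteq> q" "q \<subseteq> top A'" for q A A'
    proof -
      consider "A \<in> F" | "A' \<in> F" | "A \<in> R" "A' \<in> R \<union> S" | "A' \<in> R" "A \<in> R \<union> S" | "A \<in> S" "A' \<in> S"
        using AA'(1,2) by blast
      then show ?thesis
      proof cases
        case 1
        then show ?thesis using FX[of A q A'] AA' by blast
      next
        case 2
        then show ?thesis using FX[of A' q A] AA' by blast
      next
        case 3
        then show ?thesis using RX[of A q A'] AA' by blast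
      next
        case 4
        then show ?thesis using RX[of A' q A] AA' by blast
      next
        case 5
        then show ?thesis using AA' topS by auto
      qed
    qed
  qed
qed

end

theorem theorem1p5:
  fixes I J :: "('n::finite, 'k::field) mpoly set"
    and F H :: "'n expo set"
    and d k :: nat
  assumes "d > 0"
    and "sqfree_monomial_ideal I" and "sqfree_monomial_ideal J" and "J \<subset> I"
    and "J = {0} \<or> (\<exists>G. (\<forall>t\<in>G. sqfree t \<and> deg t \<ge> d + 1) \<and> J = ideal.span (monom ` G))"
    and "finite F" and "card F = k"
    and "\<forall>t\<in>F. sqfree t \<and> deg t = d"
    and "\<forall>t\<in>H. sqfree t \<and> deg t \<ge> d + 1"
    and "minimally_generated_by I (monom ` (F \<union> H))"
    and "sdepth I J = d + 1"
    and "k = 1 \<or> (1 < k \<and> k \<le> 3 \<and> H = {})"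
  shows "depth I J \<le> enat (d + 1)"
proof (rule ccontr)
  assume "\<not> ?thesis"
  then have "enat (d + 1) < depth I J" by simp
  then obtain gs where gs: "set gs \<subseteq> ideal.span (range var)" "regular_sequence I J gs"
    and "enat (d + 1) < enat (length gs)"
    unfolding depth_def less_Sup_iff by blast
  then have len: "Suc (Suc d) \<le> length gs" by simp
  define U where "U = {A. \<exists>t\<in>F \<union> H. Poly_Mapping.keys t \<subseteq> A}"
  have I: "I = supported_on U"
    unfolding U_def using assms(8-10)
    by (subst span_monom[symmetric]) (auto simp: minimally_generated_by_def)
  obtain G where G: "\<And>t. t \<in> G \<Longrightarrow> sqfree t" "\<And>t. t \<in> G \<Longrightarrow> Suc d \<le> deg t"
    and JG: "J = ideal.span (monom ` G)"
  proof (cases "J = {0}")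
    case True
    then show ?thesis by (intro that[of "{}"]) auto
  next
    case False
    then show ?thesis using assms(5) that by auto
  qed
  define V where "V = {A. \<exists>t\<in>G. Poly_Mapping.keys t \<subseteq> A}"
  have J: "J = supported_on V"
    unfolding V_def JG using G(1) by (rule span_monom)
  have up: "A' \<in> U" if "A \<in> U" "A \<subseteq> A'" for A A' using that by (auto simp: U_def)
  have upV: "A' \<in> V" if "A \<in> V" "A \<subseteq> A'" for A A' using that by (auto simp: V_def)
  have cardU: "\<exists>t. Poly_Mapping.keys t \<subseteq> A \<and> d \<le> card (Poly_Mapping.keys t) \<and>
      (card (Poly_Mapping.keys t) = d \<longrightarrow> t \<in> F)" if A: "A \<in> U" for A
  proof -
    obtain t where t: "t \<in> F \<union> H" "Poly_Mapping.keys t \<subseteq> A" using A unfolding U_def by blast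
    then have "sqfree t" using assms(8,9) by blast
    then show ?thesis using t assms(8,9) deg_sqfree[of t] by (intro exI[of _ t]) auto
  qed
  have geU: "d \<le> card A" if "A \<in> U" for A
    using cardU[OF that] card_mono[of A] by (meson finite order_trans)
  have geV: "Suc d \<le> card A" if A: "A \<in> V" for A
  proof -
    obtain t where "t \<in> G" "Poly_Mapping.keys t \<subseteq> A" using A by (auto simp: V_def)
    then show ?thesis using G[of t] deg_sqfree[of t] card_mono[of A "Poly_Mapping.keys t"] by simp
  qed
  let ?F = "{A\<in>U. card A = d}"
  let ?B = "{A\<in>U - V. card A = Suc d}"
  let ?C = "{A\<in>U - V. card A = Suc (Suc d)}"
  \<comment> \<open>A generator from \<open>H\<close> involves more than d variables, so its support
    lies below no set of size d.\<close>
  have "?F \<subseteq> Poly_Mapping.keys ` F"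
  proof
    fix A assume A: "A \<in> ?F"
    then obtain t where t: "Poly_Mapping.keys t \<subseteq> A" "d \<le> card (Poly_Mapping.keys t)"
      "card (Poly_Mapping.keys t) = d \<longrightarrow> t \<in> F" using cardU by blast
    then have "Poly_Mapping.keys t = A" using A by (intro card_seteq) auto
    then show "A \<in> Poly_Mapping.keys ` F" using t(3) A by blast
  qed
  then have "card ?F \<le> card F"
    using surj_card_le[OF assms(6)] by blast
  then have card3: "card ?F \<le> 3" using assms(7,12) by auto
  have "F \<noteq> {}" using assms(7,12) by auto
  then obtain t where "t \<in> F" by blast
  then have ne: "Poly_Mapping.keys t \<in> ?F"
    using assms(8) deg_sqfree[of t] by (auto simp: U_def)
  note levels = three_levels_of_regular_sequence[of U V d gs, folded I J]
  interpret three_levels ?F ?B ?C d "TYPE('k)"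
    by (rule levels(1); fact up upV geU geV assms(1) gs len)
  have "exact ?F ?B ?C"
    by (rule levels(2); fact up upV geU geV assms(1) gs len)
  then obtain p m where tops: "tops ?F ?B ?C p m"
    using tops_exist[OF subset_refl card3 subset_refl subset_refl above_subset] by blast
  \<comment> \<open>Members of \<open>V\<close> have at least d + 1 elements, so none has size
    d.\<close>
  have F_eq: "?F = {A\<in>U - V. card A = d}" using geV by force
  obtain X top where X: "?F \<subseteq> X" "\<And>A. A \<in> X \<Longrightarrow> A \<in> U" "\<And>A. A \<in> X \<Longrightarrow> A \<subseteq> top A"
    "\<And>A. A \<in> X \<Longrightarrow> top A \<notin> V" "\<And>A. A \<in> X \<Longrightarrow> Suc (Suc d) \<le> card (top A)"
    "\<And>q. q \<in> U \<Longrightarrow> q \<notin> V \<Longrightarrow> \<exists>A\<in>X. A \<subseteq> q \<and> q \<subseteq> top A"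
    "\<And>q A A'. A \<in> X \<Longrightarrow> A' \<in> X \<Longrightarrow> A \<subseteq> q \<Longrightarrow> q \<subseteq> top A \<Longrightarrow> A' \<subseteq> q \<Longrightarrow> q \<subseteq> top A' \<Longrightarrow> A = A'"
  proof (rule partition_of_tops[of U V p m])
    show "d \<le> card A" if "A \<in> U" for A using that by (rule geU)
    show "A' \<in> U" if "A \<in> U" "A \<subseteq> A'" for A A' using that by (rule up)
    show "A' \<in> V" if "A \<in> V" "A \<subseteq> A'" for A A' using that by (rule upV)
  qed (rule F_eq refl tops | (rule that; assumption))+
  obtain D where D: "set D = (\<lambda>A. (expo_of A, top A)) ` X" "distinct D"
    using finite_distinct_list[of "(\<lambda>A. (expo_of A, top A)) ` X"] by auto
  have "stanley_decomposition I J D"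
    unfolding I J by (rule stanley_decomposition_of_partition; fact up upV X D)
  moreover have "D \<noteq> []" using D(1) X(1) ne by auto
  moreover have "Suc (Suc d) \<le> card Z" if "(u, Z) \<in> set D" for u Z
    using that D(1) X(5) by auto
  ultimately have "Suc (Suc d) \<le> sdepth I J" by (rule sdepth_ge)
  then show False using assms(11) by simp
qed

end
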